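(* Let $k\ge3$ and $m\ge1$, and let $r,s$ be integers such that $1\le r\le\frac{(m-1)(k-2)+2}{k-1}$ and $1\le s\le k-1$. (a) The simplicial complex $\mathsf D_+(k,m)$ contains copies of the staircase triangulation $\Sigma(r,s)$ of the product of simplices $\Delta^{r-1}\times\Delta^{s-1}$. (b) The polytopal complex $\mathsf D(k,m)$ contains copies of the polytopal complex $\mathcal C(r,s)$.
   Context: Let $N=m(k-2)+2$ and consider a convex $N$-gon. $\delta(k,m)$ is the set of $k$-allowable diagonals: those that can appear in a dissection of the $N$-gon into $m$ convex $k$-gons. $I(k,m)$ is the graph on $\delta(k,m)$ in which two distinct diagonals are joined by an edge if their relative interiors do not intersect. For a loopless graph $H$ with $V(H)=[h]$: $\mathrm{Hom}(K_g,H)$ is the polytopal complex of all cells $\times_{i\in[g]}\sigma_i$ with $\emptyset\ne\sigma_i\subset V(H)$ such that for $i\ne j$ every $(u,v)\in\sigma_i\times\sigma_j$ is an edge of $H$; $\mathrm{Hom}_+(K_g,H)$ is the simplicial complex of all simplices $\star_{i\in[g]}\sigma_i$, $\sigma_i\subset V(H)$ possibly empty, with the same condition for all $i\ne j$ with both $\sigma_i,\sigma_j$ nonempty. Identify subsets of $V(H)$ with faces of $\Delta_{V(H)}=\mathrm{conv}\{e_1,\dots,e_h\}\subset\mathbb R^h$. The canonical projections of cells are $\pi(\times_i\sigma_i)=\frac1g(\sigma_1+\dots+\sigma_g)$ (Minkowski sum) and $\pi(\star_i\sigma_i)=\mathrm{conv}\bigcup_i\sigma_i$, and $\mathsf D(k,m)=\pi\mathrm{Hom}(K_{m-1},I(k,m))$,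 $\mathsf D_+(k,m)=\pi\mathrm{Hom}_+(K_{m-1},I(k,m))$ are the families of projected cells. Staircase triangulation: a lattice path in $[r]\times[s]$ is a connected chain of horizontal and vertical unit segments joining $(1,1)$ to $(r,s)$, weakly monotone in both coordinates, identified with its vertex set; partial lattice paths are subsets of lattice paths. Identifying $(i,j)$ with the vertex $(e_i,e_j)$ of $\Delta^{r-1}\times\Delta^{s-1}\subset\mathbb R^r\times\mathbb R^s$, the partial lattice paths index the simplices of the staircase triangulation $\Sigma(r,s)$. $\mathcal C(r,s)$ is the polytopal complex whose cells are the non-empty intersections of simplices of $\Sigma(r,s)$ with the plane $\{(\frac1r,\dots,\frac1r)\}\times\mathbb R^s$. A "copy" of a complex is a subcomplex isomorphic to it (isomorphism of face posets).
   Formalization: The case k = 3, m = 1 is excluded: there the polygon is a triangle with no diagonals, so D_+(3,1) has no vertices and cannot contain Σ(1,s), and the claim fails. *)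

theory Defs
  imports "HOL-Analysis.Analysis" "HOL-Library.Function_Algebras" "HOL-Library.Set_Algebras"
begin

text \<open>
  The index set of \<open>\<real>\<^sup>V\<close>, for \<open>V\<close> the vertex set of a graph or \<open>V = [r]\<close>, depends on parameters of
  the theorem. A point of \<open>\<real>\<^sup>V\<close> is therefore a real function that vanishes off \<open>V\<close>. The pointwise
  vector space structure below makes \<open>convex hull\<close>, \<open>face_of\<close> and \<open>polytope\<close> available.
\<close>

instantiation "fun" :: (type, real_vector) real_vector
begin

definition scaleR_fun_def: "c *\<^sub>R f = (\<lambda>x. c *\<^sub>R f x)"

instance
  by standard (auto simp: scaleR_fun_def fun_eq_iff scaleR_add_right scaleR_add_left)

end

definition coord_space :: "'v set \<Rightarrow> ('v \<Rightarrow> real) set" where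
  "coord_space V = {x. \<forall>v. v \<notin> V \<longrightarrow> x v = 0}"

definition unit_vec :: "'v \<Rightarrow> 'v \<Rightarrow> real" where
  "unit_vec v = (\<lambda>w. if w = v then 1 else 0)"


section \<open>Polytopal complexes\<close>

text \<open>
  The empty face need not be a member, so that both families of non-empty cells and simplicial
  complexes with their empty simplex are covered.
\<close>

definition polytopal_complex :: "'a::real_vector set set \<Rightarrow> bool" where
  "polytopal_complex K \<longleftrightarrow>
     finite K \<and>
     (\<forall>P\<in>K. polytope P) \<and>
     (\<forall>P\<in>K. \<forall>F. F face_of P \<and> F \<noteq> {} \<longrightarrow> F \<in> K) \<and>
     (\<forall>P\<in>K. \<forall>Q\<in>K. (P \<inter> Q) face_of P \<and> (P \<inter> Q) face_of Q)"

definition subcomplex :: "'a::real_vector set set \<Rightarrow> 'a set set \<Rightarrow> bool" where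
  "subcomplex L K \<longleftrightarrow> L \<subseteq> K \<and> polytopal_complex L"

definition face_poset_iso :: "'a set set \<Rightarrow> 'b set set \<Rightarrow> bool" where
  "face_poset_iso L M \<longleftrightarrow>
     (\<exists>\<phi>. bij_betw \<phi> L M \<and> (\<forall>P\<in>L. \<forall>Q\<in>L. P \<subseteq> Q \<longleftrightarrow> \<phi> P \<subseteq> \<phi> Q))"

definition contains_copy :: "'a::real_vector set set \<Rightarrow> 'b set set \<Rightarrow> bool" where
  "contains_copy K M \<longleftrightarrow> (\<exists>L. subcomplex L K \<and> face_poset_iso L M)"


section \<open>Dissections of convex polygons\<close>

definition vertices :: "(real^2) set \<Rightarrow> (real^2) set" where
  "vertices P = {v. v extreme_point_of P}"

definition convex_gon :: "nat \<Rightarrow> (real^2) set \<Rightarrow> bool" where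
  "convex_gon n P \<longleftrightarrow> polytope P \<and> aff_dim P = 2 \<and> card (vertices P) = n"

definition diagonals :: "(real^2) set \<Rightarrow> (real^2) set set" where
  "diagonals P = {closed_segment a b | a b.
     a \<in> vertices P \<and> b \<in> vertices P \<and> a \<noteq> b \<and> \<not> closed_segment a b edge_of P}"

text \<open>
  A dissection cuts the polygon along diagonals only, so the vertices of the pieces are vertices of
  the polygon. A diagonal appears in a dissection if it is a side of one of the pieces.
\<close>

definition dissection :: "nat \<Rightarrow> nat \<Rightarrow> (real^2) set \<Rightarrow> (real^2) set set \<Rightarrow> bool" where
  "dissection k m P \<Q> \<longleftrightarrow>
     finite \<Q> \<and> card \<Q> = m \<and>
     (\<forall>Q\<in>\<Q>. convex_gon k Q \<and> vertices Q \<subseteq> vertices P) \<and>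
     \<Union>\<Q> = P \<and>
     (\<forall>Q\<in>\<Q>. \<forall>R\<in>\<Q>. Q \<noteq> R \<longrightarrow> interior Q \<inter> interior R = {})"

definition allowable_diagonals :: "nat \<Rightarrow> nat \<Rightarrow> (real^2) set \<Rightarrow> (real^2) set set" where
  "allowable_diagonals k m P =
     {d \<in> diagonals P. \<exists>\<Q>. dissection k m P \<Q> \<and> (\<exists>Q\<in>\<Q>. d edge_of Q)}"

text \<open>The edge relation of \<open>I(k,m)\<close>; its vertex set is \<open>allowable_diagonals k m P\<close>.\<close>

definition noncrossing :: "(real^2) set \<Rightarrow> (real^2) set \<Rightarrow> bool" where
  "noncrossing d d' \<longleftrightarrow> d \<noteq> d' \<and> rel_interior d \<inter> rel_interior d' = {}"


section \<open>Hom-complexes and their projections\<close>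

text \<open>
  Cells are represented by their index tuples \<open>(\<sigma>\<^sub>1, \<dots>, \<sigma>\<^sub>g)\<close>; a subset \<open>\<sigma>\<^sub>i\<close> of \<open>V\<close> stands for the
  face \<open>simplex_face \<sigma>\<^sub>i\<close> of \<open>\<Delta>\<^sub>V\<close>.
\<close>

definition simplex_face :: "'v set \<Rightarrow> ('v \<Rightarrow> real) set" where
  "simplex_face A = convex hull (unit_vec ` A)"

definition Hom_plus :: "nat \<Rightarrow> 'v set \<Rightarrow> ('v \<Rightarrow> 'v \<Rightarrow> bool) \<Rightarrow> (nat \<Rightarrow> 'v set) set" where
  "Hom_plus g V E =
     {\<sigma> \<in> {1..g} \<rightarrow>\<^sub>E Pow V.
       \<forall>i\<in>{1..g}. \<forall>j\<in>{1..g}. i \<noteq> j \<and> \<sigma> i \<noteq> {} \<and> \<sigma> j \<noteq> {} \<longrightarrow> (\<forall>u\<in>\<sigma> i. \<forall>v\<in>\<sigma> j. E u v)}"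

definition Hom :: "nat \<Rightarrow> 'v set \<Rightarrow> ('v \<Rightarrow> 'v \<Rightarrow> bool) \<Rightarrow> (nat \<Rightarrow> 'v set) set" where
  "Hom g V E =
     {\<sigma> \<in> {1..g} \<rightarrow>\<^sub>E (Pow V - {{}}).
       \<forall>i\<in>{1..g}. \<forall>j\<in>{1..g}. i \<noteq> j \<longrightarrow> (\<forall>u\<in>\<sigma> i. \<forall>v\<in>\<sigma> j. E u v)}"

text \<open>The sum of sets is the Minkowski sum.\<close>

definition proj_Hom :: "nat \<Rightarrow> (nat \<Rightarrow> 'v set) \<Rightarrow> ('v \<Rightarrow> real) set" where
  "proj_Hom g \<sigma> = (*\<^sub>R) (1 / real g) ` (\<Sum>i\<in>{1..g}. simplex_face (\<sigma> i))"

definition proj_Hom_plus :: "nat \<Rightarrow> (nat \<Rightarrow> 'v set) \<Rightarrow> ('v \<Rightarrow> real) set" where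
  "proj_Hom_plus g \<sigma> = convex hull (\<Union>i\<in>{1..g}. simplex_face (\<sigma> i))"

definition D_complex :: "nat \<Rightarrow> nat \<Rightarrow> (real^2) set \<Rightarrow> ((real^2) set \<Rightarrow> real) set set" where
  "D_complex k m P =
     proj_Hom (m - 1) ` Hom (m - 1) (allowable_diagonals k m P) noncrossing"

definition D_plus_complex :: "nat \<Rightarrow> nat \<Rightarrow> (real^2) set \<Rightarrow> ((real^2) set \<Rightarrow> real) set set" where
  "D_plus_complex k m P =
     proj_Hom_plus (m - 1) ` Hom_plus (m - 1) (allowable_diagonals k m P) noncrossing"


section \<open>Staircase triangulations\<close>

definition unit_step :: "nat \<times> nat \<Rightarrow> nat \<times> nat \<Rightarrow> bool" where
  "unit_step p q \<longleftrightarrow> q = (fst p + 1, snd p) \<or> q = (fst p, snd p + 1)"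

definition lattice_paths :: "nat \<Rightarrow> nat \<Rightarrow> (nat \<times> nat) set set" where
  "lattice_paths r s =
     {set ps | ps. ps \<noteq> [] \<and> hd ps = (1, 1) \<and> last ps = (r, s) \<and> successively unit_step ps}"

definition partial_lattice_paths :: "nat \<Rightarrow> nat \<Rightarrow> (nat \<times> nat) set set" where
  "partial_lattice_paths r s = {A. \<exists>B\<in>lattice_paths r s. A \<subseteq> B}"

definition staircase :: "nat \<Rightarrow> nat \<Rightarrow> ((nat \<Rightarrow> real) \<times> (nat \<Rightarrow> real)) set set" where
  "staircase r s =
     (\<lambda>A. convex hull ((\<lambda>(i, j). (unit_vec i, unit_vec j)) ` A)) ` partial_lattice_paths r s"

definition staircase_slice :: "nat \<Rightarrow> nat \<Rightarrow> ((nat \<Rightarrow> real) \<times> (nat \<Rightarrow> real)) set set" where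
  "staircase_slice r s =
     {T \<inter> ({\<lambda>i. if i \<in> {1..r} then 1 / real r else 0} \<times> coord_space {1..s}) | T.
        T \<in> staircase r s} - {{}}"

end

theory Submission
  imports Defs
begin

text \<open>
  Number the vertices of the polygon \<open>1, \<dots>, N\<close> in cyclic order and let \<open>d(i, j)\<close> be the chord from \<open>j\<close>
  to \<open>j + (m - i) (k - 2) + 1\<close>, for \<open>1 \<le> i \<le> m - 1\<close> and \<open>1 \<le> j \<le> k - 1\<close>. All these chords are
  \<open>k\<close>-allowable, and \<open>d(i', j')\<close> is nested inside \<open>d(i, j)\<close> whenever \<open>i < i'\<close> and \<open>j \<le> j'\<close>. The bound
  on \<open>r\<close> implies \<open>r \<le> m - 1\<close>. Hence a partial lattice path with rows \<open>A\<^sub>1, \<dots>, A\<^sub>r\<close>, all non-empty,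
  yields a cell of the Hom-complex with colour classes \<open>{d(i, j) | j \<in> A\<^sub>i}\<close> for \<open>i \<le> r\<close> and
  \<open>{d(i, s)}\<close> for \<open>i > r\<close>. The projected cell is a product of simplices whose faces are found by
  shrinking its classes. By the Cayley trick the slice of the staircase simplex of the path is
  indexed by the same data: the barycentric coordinates of a point of the slice form a coupling
  supported on a chain, and such a coupling is determined by its marginals.
\<close>

section \<open>Cells cut out of the non-negative orthant\<close>

text \<open>Containing a copy asks for a subfamily that is itself a polytopal complex. For D(k, m)
  this is achieved by sending row i of the grid once and for all to its own block of diagonals. The
  blocks are disjoint, so all chosen cells are cut out of the non-negative orthant by one affine
  subspace and are governed by their supports: faces shrink supports, intersections intersect them.
  The slice is not of this form in its own coordinates. It is only a linear image of such cells,
  under a map that is not injective on all couplings. Both families are therefore compared with a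
  third poset, the paths that meet every row, ordered by inclusion. The bound s \<le> k - 1 works
  twice: the longest chord from vertex k - 1 ends exactly at N, and a column shift of at most k - 2
  is absorbed by the loss of k - 2 in length from each row to the next. For (k, m) = (3, 1) the
  bound on r would allow r = 1 although there are m - 1 = 0 colour classes and D_+ has no non-empty
  simplex; this is why that pair is excluded.\<close>

lemma sum_fun_apply: "(\<Sum>i\<in>I. f i) x = (\<Sum>i\<in>I. f i x)" for f :: "'a \<Rightarrow> 'b \<Rightarrow> real"
  by (induction I rule: infinite_finite_induct) auto

lemma scaleR_fun_apply [simp]: "(c *\<^sub>R f) x = c *\<^sub>R f x"
  by (simp add: scaleR_fun_def)

text \<open>A normal form shared by simplices, by the projected Hom cells and, in barycentric
  coordinates, by the staircase slices. Only the support set \<open>A\<close> varies inside a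
  family, while \<open>W\<close> stays fixed.\<close>

definition std_cell :: "('v \<Rightarrow> real) set \<Rightarrow> 'v set \<Rightarrow> ('v \<Rightarrow> real) set" where
  "std_cell W A = {x \<in> W. (\<forall>v. 0 \<le> x v) \<and> (\<forall>v. v \<notin> A \<longrightarrow> x v = 0)}"

lemma std_cell_mono: "A \<subseteq> B \<Longrightarrow> std_cell W A \<subseteq> std_cell W B"
  by (auto simp: std_cell_def)

lemma std_cell_Int: "std_cell W A \<inter> std_cell W B = std_cell W (A \<inter> B)"
  by (auto simp: std_cell_def)

lemma convex_std_cell:
  assumes "affine W"
  shows "convex (std_cell W A)"
proof (rule convexI)
  fix x y and u w :: real
  assume *: "x \<in> std_cell W A" "y \<in> std_cell W A" "0 \<le> u" "0 \<le> w" "u + w = 1"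
  then have "u *\<^sub>R x + w *\<^sub>R y \<in> W"
    using assms by (auto simp: affine_def std_cell_def)
  with * show "u *\<^sub>R x + w *\<^sub>R y \<in> std_cell W A"
    by (auto simp: std_cell_def)
qed

text \<open>A coordinate that vanishes strictly between two non-negative points vanishes at both of
  them.\<close>

lemma std_cell_face_of:
  assumes "affine W" "A \<subseteq> B"
  shows "std_cell W A face_of std_cell W B"
  unfolding face_of_def
proof (intro conjI ballI impI)
  show "std_cell W A \<subseteq> std_cell W B"
    using assms by (simp add: std_cell_mono)
  show "convex (std_cell W A)"
    by (simp add: assms convex_std_cell)
  fix a b x
  assume a: "a \<in> std_cell W B" and b: "b \<in> std_cell W B" and x: "x \<in> std_cell W A"
    and "x \<in> open_segment a b"
  then obtain u where u: "0 < u" "u < 1" "x = (1 - u) *\<^sub>R a + u *\<^sub>R b"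
    by (auto simp: in_segment)
  have "a v = 0 \<and> b v = 0" if "v \<notin> A" for v
  proof -
    have "(1 - u) * a v + u * b v = 0"
      using x u that by (auto simp: std_cell_def)
    moreover have "0 \<le> (1 - u) * a v" "0 \<le> u * b v"
      using a b u by (auto simp: std_cell_def)
    ultimately have "(1 - u) * a v = 0" "u * b v = 0"
      by linarith+
    then show ?thesis
      using u by auto
  qed
  then show "a \<in> std_cell W A" "b \<in> std_cell W A"
    using a b by (auto simp: std_cell_def)
qed

text \<open>A point of \<open>F\<close> of largest support is relatively interior to the cell of its support, and a
  face that meets the relative interior of a cell contains it.\<close>

lemma face_of_std_cell:
  assumes W: "affine W" and "finite A" and F: "F face_of std_cell W A" and "F \<noteq> {}"
  obtains B where "B \<subseteq> A" "F = std_cell W B"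
proof -
  define supp where "supp x = {v. x v \<noteq> 0}" for x :: "'a \<Rightarrow> real"
  have sub: "F \<subseteq> std_cell W A" and cF: "convex F"
    using F by (auto simp: face_of_def)
  have suppA: "supp x \<subseteq> A" if "x \<in> F" for x
    using that sub by (auto simp: supp_def std_cell_def)
  have fin: "finite (supp x)" if "x \<in> F" for x
    using suppA that \<open>finite A\<close> finite_subset by blast
  obtain x0 where "x0 \<in> F"
    using \<open>F \<noteq> {}\<close> by auto
  have "\<forall>y. y \<in> F \<longrightarrow> card (supp y) < Suc (card A)"
    by (simp add: suppA \<open>finite A\<close> card_mono le_imp_less_Suc)
  then obtain x where x: "x \<in> F" and max: "\<And>y. y \<in> F \<Longrightarrow> card (supp y) \<le> card (supp x)"
    using ex_has_greatest_nat[of "\<lambda>x. x \<in> F" x0 "\<lambda>x. card (supp x)" "Suc (card A)"] \<open>x0 \<in> F\<close>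
    by auto
  have max': "supp y \<subseteq> supp x" if y: "y \<in> F" for y
  proof -
    \<comment> \<open>Non-negative coordinates cannot cancel, so the support of the midpoint is the
      union of the two supports.\<close>
    define z where "z = (1/2) *\<^sub>R x + (1/2) *\<^sub>R y"
    have z: "z \<in> F"
      unfolding z_def using x y cF by (intro convexD) auto
    have nonneg: "0 \<le> x v" "0 \<le> y v" for v
      using x y sub by (auto simp: std_cell_def)
    have "supp z = supp x \<union> supp y"
      using nonneg by (auto simp: supp_def z_def add_nonneg_eq_0_iff)
    moreover have "card (supp z) \<le> card (supp x)"
      using max z by simp
    ultimately have "supp x = supp z"
      using card_seteq[OF fin[OF z], of "supp x"] by auto
    with \<open>supp z = supp x \<union> supp y\<close> show ?thesis
      by auto
  qed
  show thesis
  proof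
    show "supp x \<subseteq> A"
      using suppA x by simp
    show "F = std_cell W (supp x)"
    proof
      show "F \<subseteq> std_cell W (supp x)"
        using max' sub by (auto simp: std_cell_def supp_def)
      show "std_cell W (supp x) \<subseteq> F"
      proof
        fix y assume y: "y \<in> std_cell W (supp x)"
        show "y \<in> F"
        proof (cases "y = x")
          case True
          with x show ?thesis by simp
        next
          case False
          \<comment> \<open>The segment from \<open>y\<close> to \<open>x\<close> is prolonged
            beyond \<open>x\<close> by a small amount that keeps every coordinate non-negative. The
            summand 1 in the denominator covers \<open>y v = 0\<close>, and the inserted 1 keeps the
            minimum well defined if the support is empty.\<close>
          define \<epsilon> where "\<epsilon> = Min (insert 1 ((\<lambda>v. x v / (1 + y v)) ` supp x))"
          have xpos: "0 < x v" if "v \<in> supp x" for v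
            using that x sub by (auto simp: std_cell_def supp_def order_less_le)
          have ynn: "0 \<le> y v" for v
            using y by (auto simp: std_cell_def)
          have fin': "finite (insert 1 ((\<lambda>v. x v / (1 + y v)) ` supp x))"
            using fin x by simp
          have "0 < x v / (1 + y v)" if "v \<in> supp x" for v
            using xpos that ynn by (intro divide_pos_pos) (auto intro: add_pos_nonneg)
          then have \<epsilon>0: "0 < \<epsilon>"
            unfolding \<epsilon>_def using fin' by (subst Min_gr_iff) auto
          have \<epsilon>le: "\<epsilon> * y v \<le> x v" if "v \<in> supp x" for v
          proof -
            have "\<epsilon> \<le> x v / (1 + y v)"
              unfolding \<epsilon>_def using fin' that by (intro Min_le) auto
            then have "\<epsilon> * (1 + y v) \<le> x v"
              using ynn[of v] by (simp add: pos_le_divide_eq add_pos_nonneg)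
            with \<epsilon>0 show ?thesis
              by (simp add: distrib_left)
          qed
          define z where "z = (1 + \<epsilon>) *\<^sub>R x + (-\<epsilon>) *\<^sub>R y"
          have "z \<in> W"
            unfolding z_def using W x y sub
            by (intro mem_affine) (auto simp: std_cell_def)
          moreover have "0 \<le> z v" for v
          proof (cases "v \<in> supp x")
            case True
            then show ?thesis
              using \<epsilon>le[OF True] mult_nonneg_nonneg[of \<epsilon> "x v"] \<epsilon>0 xpos[OF True]
              by (simp add: z_def distrib_right add_increasing2)
          next
            case False
            then have "y v = 0" "x v = 0"
              using y by (auto simp: supp_def std_cell_def)
            then show ?thesis
              by (simp add: z_def)
          qed
          moreover have "z v = 0" if "v \<notin> A" for v
          proof -
            have "v \<notin> supp x"
              using that suppA x by auto
            then have "y v = 0" "x v = 0"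
              using y by (auto simp: supp_def std_cell_def)
            then show ?thesis
              by (simp add: z_def)
          qed
          ultimately have z: "z \<in> std_cell W A"
            by (auto simp: std_cell_def)
          have yA: "y \<in> std_cell W A"
            using y suppA[OF x] std_cell_mono by blast
          \<comment> \<open>Solving \<open>z = (1 + \<epsilon>) x - \<epsilon> y\<close> for
            \<open>x\<close> gives this parameter on the segment from \<open>y\<close> to
            \<open>z\<close>.\<close>
          define t where "t = 1 / (1 + \<epsilon>)"
          have t: "t * (1 + \<epsilon>) = 1"
            using \<epsilon>0 by (simp add: t_def)
          have "(1 - t) * y v + t * z v = t * (1 + \<epsilon>) * x v + (1 - t * (1 + \<epsilon>)) * y v" for v
            by (simp add: z_def algebra_simps)
          then have "x = (1 - t) *\<^sub>R y + t *\<^sub>R z"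
            by (simp add: t fun_eq_iff)
          moreover have "y \<noteq> z"
          proof
            assume "y = z"
            have "x v = y v" for v
            proof -
              have "(1 + \<epsilon>) * y v = (1 + \<epsilon>) * x v"
                using arg_cong[OF \<open>y = z\<close>, of "\<lambda>f. f v"] by (simp add: z_def algebra_simps)
              then show ?thesis
                using \<epsilon>0 by simp
            qed
            with False show False
              by auto
          qed
          ultimately have "x \<in> open_segment y z"
            using \<epsilon>0 unfolding in_segment t_def by (auto intro!: exI[of _ "1 / (1 + \<epsilon>)"])
          then show "y \<in> F"
            using F x yA z unfolding face_of_def by blast
        qed
      qed
    qed
  qed
qed

text \<open>By \<open>face_of_std_cell\<close> every non-empty face comes from a smaller support, so
  closure under shrinking, as long as the cell stays non-empty, is enough. Being a polytope is
  assumed because an affine section of the orthant may be unbounded.\<close>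

lemma polytopal_complex_std_cells:
  assumes "affine W" "finite \<A>"
    and fin: "\<And>A. A \<in> \<A> \<Longrightarrow> finite A"
    and poly: "\<And>A. A \<in> \<A> \<Longrightarrow> polytope (std_cell W A)"
    and down: "\<And>A B. A \<in> \<A> \<Longrightarrow> B \<subseteq> A \<Longrightarrow> std_cell W B \<noteq> {} \<Longrightarrow> B \<in> \<A>"
  shows "polytopal_complex (std_cell W ` \<A>)"
  unfolding polytopal_complex_def
proof (intro conjI ballI allI impI)
  show "finite (std_cell W ` \<A>)"
    using assms by simp
  fix P assume "P \<in> std_cell W ` \<A>"
  then obtain A where A: "A \<in> \<A>" "P = std_cell W A"
    by auto
  then show "polytope P"
    using poly by simp
  show "F \<in> std_cell W ` \<A>" if "F face_of P \<and> F \<noteq> {}" for F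
    using that A face_of_std_cell[OF assms(1) fin] down by (metis imageI)
  fix Q assume "Q \<in> std_cell W ` \<A>"
  then obtain B where B: "Q = std_cell W B"
    by auto
  show "P \<inter> Q face_of P" "P \<inter> Q face_of Q"
    using A B assms(1) by (auto simp: std_cell_Int intro!: std_cell_face_of)
qed

text \<open>One point whose support is all of \<open>A\<close> tests the inclusion.\<close>

lemma std_cell_subset_iff:
  assumes "x \<in> std_cell W A" "\<And>v. v \<in> A \<Longrightarrow> x v \<noteq> 0"
  shows "std_cell W A \<subseteq> std_cell W B \<longleftrightarrow> A \<subseteq> B"
proof
  assume "std_cell W A \<subseteq> std_cell W B"
  then have "x \<in> std_cell W B"
    using assms by auto
  with assms(2) show "A \<subseteq> B"
    by (auto simp: std_cell_def)
qed (rule std_cell_mono)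

text \<open>Order embeddings are injective, so two families indexed by the same sets are matched
  through their indices.\<close>

lemma face_poset_isoI:
  assumes L: "\<And>A B. A \<in> \<A> \<Longrightarrow> B \<in> \<A> \<Longrightarrow> C A \<subseteq> C B \<longleftrightarrow> A \<subseteq> B"
    and M: "\<And>A B. A \<in> \<A> \<Longrightarrow> B \<in> \<A> \<Longrightarrow> D A \<subseteq> D B \<longleftrightarrow> A \<subseteq> B"
  shows "face_poset_iso (C ` \<A>) (D ` \<A>)"
proof -
  have C: "inj_on C \<A>" and D: "inj_on D \<A>"
    using L M by (auto intro!: inj_onI) (metis order.refl subset_antisym)+
  define \<phi> where "\<phi> = D \<circ> inv_into \<A> C"
  have "bij_betw \<phi> (C ` \<A>) (D ` \<A>)"
    unfolding \<phi>_def using C D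
    by (intro bij_betw_trans[OF bij_betw_inv_into]) (auto simp: bij_betw_def)
  moreover have "\<forall>P\<in>C ` \<A>. \<forall>Q\<in>C ` \<A>. P \<subseteq> Q \<longleftrightarrow> \<phi> P \<subseteq> \<phi> Q"
    using C L M by (auto simp: \<phi>_def)
  ultimately show ?thesis
    unfolding face_poset_iso_def by blast
qed

section \<open>Simplices and scaled Minkowski sums as cells of the orthant\<close>

text \<open>The weights are indexed by \<open>A\<close> and extended by zero, so that a weight
  function can itself be a point of a \<open>std_cell\<close>.\<close>

lemma convex_hull_image_finite:
  fixes h :: "'b \<Rightarrow> 'a::real_vector"
  assumes "finite A" "inj_on h A"
  shows "convex hull (h ` A) =
    {(\<Sum>a\<in>A. u a *\<^sub>R h a) | u. (\<forall>a. 0 \<le> u a) \<and> (\<forall>a. a \<notin> A \<longrightarrow> u a = 0) \<and> sum u A = 1}"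
proof (intro equalityI subsetI)
  fix y assume "y \<in> convex hull (h ` A)"
  then obtain u where u: "\<forall>x\<in>h ` A. 0 \<le> u x" "sum u (h ` A) = 1" "(\<Sum>x\<in>h ` A. u x *\<^sub>R x) = y"
    using assms by (auto simp: convex_hull_finite)
  define w where "w a = (if a \<in> A then u (h a) else 0)" for a
  have "y = (\<Sum>a\<in>A. w a *\<^sub>R h a)" "\<forall>a. 0 \<le> w a" "\<forall>a. a \<notin> A \<longrightarrow> w a = 0" "sum w A = 1"
    using u assms(2) by (auto simp: w_def sum.reindex)
  then show "y \<in> {(\<Sum>a\<in>A. u a *\<^sub>R h a) | u.
      (\<forall>a. 0 \<le> u a) \<and> (\<forall>a. a \<notin> A \<longrightarrow> u a = 0) \<and> sum u A = 1}"
    by blast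
qed (use assms(1) in \<open>auto intro!: convex_sum convex_convex_hull intro: hull_inc\<close>)

lemma inj_unit_vec: "inj unit_vec"
  by (rule injI) (metis unit_vec_def zero_neq_one)

lemma simplex_face_eq:
  assumes "finite A"
  shows "simplex_face A = {x. (\<forall>v. 0 \<le> x v) \<and> (\<forall>v. v \<notin> A \<longrightarrow> x v = 0) \<and> sum x A = 1}"
proof -
  have "(\<Sum>v\<in>A. u v *\<^sub>R unit_vec v) = u" if "\<forall>v. v \<notin> A \<longrightarrow> u v = 0" for u :: "'a \<Rightarrow> real"
    using assms that by (auto simp: fun_eq_iff sum_fun_apply unit_vec_def sum.delta if_distrib cong: if_cong)
  then show ?thesis
    using assms inj_on_subset[OF inj_unit_vec subset_UNIV, of A]
    unfolding simplex_face_def by (auto simp: convex_hull_image_finite) metis+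
qed

text \<open>The mass \<open>1 / g\<close> per block is the factor of the canonical projection. A
  single block gives the hyperplane of a standard simplex, and the rows of the grid as blocks give
  the slicing plane of the staircase triangulation.\<close>

definition blocks :: "nat \<Rightarrow> (nat \<Rightarrow> 'v set) \<Rightarrow> ('v \<Rightarrow> real) set" where
  "blocks g V = {x. \<forall>i\<in>{1..g}. sum x (V i) = 1 / real g}"

lemma simplex_face_std_cell:
  assumes "finite V" "A \<subseteq> V"
  shows "simplex_face A = std_cell (blocks 1 (\<lambda>_. V)) A"
proof -
  have "sum x V = sum x A" if "\<forall>v. v \<notin> A \<longrightarrow> x v = 0" for x :: "'a \<Rightarrow> real"
    using assms that by (intro sum.mono_neutral_right) auto
  then show ?thesis
    using assms finite_subset[OF assms(2,1)] by (auto simp: simplex_face_eq std_cell_def blocks_def)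
qed

lemma affine_blocks: "affine (blocks g V)"
  unfolding blocks_def affine_def
  by (auto simp: sum.distrib simp flip: sum_distrib_left add_divide_distrib)

lemma polytope_simplex_face: "finite A \<Longrightarrow> polytope (simplex_face A)"
  unfolding simplex_face_def polytope_def by blast

lemma polytope_set_sum:
  assumes "\<And>i. i \<in> I \<Longrightarrow> polytope (S i)"
  shows "polytope (\<Sum>i\<in>I. S i)"
  using assms
proof (induction I rule: infinite_finite_induct)
  case (insert i I)
  then obtain A B where "finite A" "S i = convex hull A" "finite B" "(\<Sum>i\<in>I. S i) = convex hull B"
    unfolding polytope_def by (metis insertCI)
  then have "(\<Sum>i\<in>insert i I. S i) = convex hull (A + B)" "finite (A + B)"
    using insert.hyps by (simp_all add: convex_hull_set_plus finite_set_plus)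
  then show ?case
    unfolding polytope_def by blast
qed (use polytope_sing[of 0] in simp_all)

lemma polytope_proj_Hom:
  assumes "\<And>i. i \<in> {1..g} \<Longrightarrow> finite (\<sigma> i)"
  shows "polytope (proj_Hom g \<sigma>)"
proof -
  have "polytope (\<Sum>i\<in>{1..g}. simplex_face (\<sigma> i))"
    using assms by (intro polytope_set_sum polytope_simplex_face) auto
  then show ?thesis
    unfolding proj_Hom_def polytope_def by (metis convex_hull_scaling finite_imageI)
qed

text \<open>Because the classes lie in disjoint blocks, a point of the Minkowski sum determines its
  summands: each is the restriction of the point to one class, rescaled by \<open>g\<close>.\<close>

lemma proj_Hom_std_cell:
  assumes "0 < g" and fin: "\<And>i. i \<in> {1..g} \<Longrightarrow> finite (V i)"
    and disj: "disjoint_family_on V {1..g}"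
    and sub: "\<And>i. i \<in> {1..g} \<Longrightarrow> \<sigma> i \<subseteq> V i"
  shows "proj_Hom g \<sigma> = std_cell (blocks g V) (\<Union>i\<in>{1..g}. \<sigma> i)"
    (is "_ = std_cell ?W ?A")
proof -
  have fin': "finite (\<sigma> i)" if "i \<in> {1..g}" for i
    using fin sub that finite_subset by blast
  have off: "v \<notin> \<sigma> j" if "v \<in> V i" "i \<in> {1..g}" "j \<in> {1..g}" "i \<noteq> j" for v i j
    using that disj sub[of j] unfolding disjoint_family_on_def by blast
  show ?thesis
  proof (intro equalityI subsetI)
    fix x assume "x \<in> proj_Hom g \<sigma>"
    then obtain s where s: "\<forall>i\<in>{1..g}. s i \<in> simplex_face (\<sigma> i)"
      and x: "x = (1 / real g) *\<^sub>R (\<Sum>i\<in>{1..g}. s i)"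
      unfolding proj_Hom_def by (auto simp: set_sum_alt)
    have s': "0 \<le> s i v" "v \<notin> \<sigma> i \<Longrightarrow> s i v = 0" "sum (s i) (\<sigma> i) = 1" if "i \<in> {1..g}" for i v
      using s fin' that by (auto simp: simplex_face_eq)
    have xv: "x v = (\<Sum>i\<in>{1..g}. s i v) / real g" for v
      by (simp add: x sum_fun_apply)
    have "x \<in> ?W"
      unfolding blocks_def
    proof (clarify)
      fix i assume i: "i \<in> {1..g}"
      have "sum x (V i) = (\<Sum>v\<in>V i. s i v / real g)"
      proof (rule sum.cong[OF refl])
        fix v assume v: "v \<in> V i"
        have "(\<Sum>j\<in>{1..g}. s j v) = (\<Sum>j\<in>{i}. s j v)"
          using off[OF v i] i s' by (intro sum.mono_neutral_right) auto
        then show "x v = s i v / real g"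
          by (simp add: xv)
      qed
      also have "\<dots> = sum (s i) (V i) / real g"
        by (simp add: sum_divide_distrib)
      also have "sum (s i) (V i) = sum (s i) (\<sigma> i)"
        using fin sub i s' by (intro sum.mono_neutral_right) auto
      finally show "sum x (V i) = 1 / real g"
        using s' i by simp
    qed
    moreover have "0 \<le> x v" for v
      using s' by (auto simp: xv intro!: divide_nonneg_nonneg sum_nonneg)
    moreover have "x v = 0" if "v \<notin> ?A" for v
      using that s' by (auto simp: xv intro!: sum.neutral)
    ultimately show "x \<in> std_cell ?W ?A"
      by (auto simp: std_cell_def blocks_def)
  next
    fix x assume x: "x \<in> std_cell ?W ?A"
    define s where "s i v = (if v \<in> \<sigma> i then real g * x v else 0)" for i v
    have "s i \<in> simplex_face (\<sigma> i)" if i: "i \<in> {1..g}" for i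
    proof -
      have "sum (s i) (\<sigma> i) = real g * sum x (\<sigma> i)"
        by (simp add: s_def sum_distrib_left)
      also have "sum x (\<sigma> i) = sum x (V i)"
      proof (rule sum.mono_neutral_left)
        show "\<forall>v\<in>V i - \<sigma> i. x v = 0"
        proof
          fix v assume v: "v \<in> V i - \<sigma> i"
          then have "v \<notin> \<sigma> j" if "j \<in> {1..g}" for j
            using off[of v i j] i that by blast
          with x show "x v = 0"
            by (auto simp: std_cell_def blocks_def)
        qed
      qed (use i fin sub in auto)
      finally have "sum (s i) (\<sigma> i) = 1"
        using x i \<open>0 < g\<close> by (auto simp: std_cell_def blocks_def)
      then show ?thesis
        using fin' i x by (auto simp: simplex_face_eq s_def std_cell_def blocks_def)
    qed
    moreover have "x = (1 / real g) *\<^sub>R (\<Sum>i\<in>{1..g}. s i)"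
    proof
      fix v
      show "x v = ((1 / real g) *\<^sub>R (\<Sum>i\<in>{1..g}. s i)) v"
      proof (cases "v \<in> ?A")
        case True
        then obtain i where i: "i \<in> {1..g}" "v \<in> \<sigma> i"
          by auto
        moreover from this have "v \<in> V i"
          using sub by blast
        ultimately have "(\<Sum>j\<in>{1..g}. s j v) = (\<Sum>j\<in>{i}. s j v)"
          using off[of v i] by (intro sum.mono_neutral_right) (auto simp: s_def)
        then show ?thesis
          using i \<open>0 < g\<close> by (simp add: sum_fun_apply s_def)
      next
        case False
        then have "(\<Sum>j\<in>{1..g}. s j v) = 0" "x v = 0"
          using x by (auto simp: s_def std_cell_def blocks_def intro!: sum.neutral)
        then show ?thesis
          by (simp add: sum_fun_apply)
      qed
    qed
    ultimately show "x \<in> proj_Hom g \<sigma>"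
      unfolding proj_Hom_def set_sum_alt[OF finite_atLeastAtMost] by blast
  qed
qed


text \<open>A block missed by the support would carry mass 0 instead of
  \<open>1 / g\<close>.\<close>

lemma std_cell_blocks_meets:
  assumes "std_cell (blocks g V) S \<noteq> {}" "i \<in> {1..g}"
  shows "S \<inter> V i \<noteq> {}"
proof
  assume *: "S \<inter> V i = {}"
  obtain x where x: "x \<in> std_cell (blocks g V) S"
    using assms by auto
  with * have "sum x (V i) = 0"
    by (intro sum.neutral) (auto simp: std_cell_def)
  then show False
    using x assms(2) by (auto simp: std_cell_def blocks_def)
qed

text \<open>Each block spreads its mass uniformly over the part of \<open>S\<close> that it
  contains. This also gives the converse of \<open>std_cell_blocks_meets\<close>, and it supplies
  the test points for inclusions of cells.\<close>

lemma std_cell_blocks_full_support: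
  assumes fin: "\<And>i. i \<in> {1..g} \<Longrightarrow> finite (V i)"
    and disj: "disjoint_family_on V {1..g}"
    and sub: "S \<subseteq> (\<Union>i\<in>{1..g}. V i)"
    and meet: "\<And>i. i \<in> {1..g} \<Longrightarrow> S \<inter> V i \<noteq> {}"
  obtains x where "x \<in> std_cell (blocks g V) S" "\<And>v. v \<in> S \<Longrightarrow> x v \<noteq> 0"
proof
  define c where "c i = 1 / (real g * real (card (S \<inter> V i)))" for i
  define x where "x v = (\<Sum>i\<in>{1..g}. if v \<in> S \<inter> V i then c i else 0)" for v
  have c: "0 < c i" if "i \<in> {1..g}" for i
    using that meet fin by (auto simp: c_def card_gt_0_iff)
  have x: "x v = c i" if "v \<in> S \<inter> V i" "i \<in> {1..g}" for v i
  proof -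
    have "v \<notin> V j" if "j \<in> {1..g}" "j \<noteq> i" for j
      using \<open>v \<in> S \<inter> V i\<close> \<open>i \<in> {1..g}\<close> that disj unfolding disjoint_family_on_def by blast
    then have "x v = (\<Sum>j\<in>{i}. if v \<in> S \<inter> V j then c j else 0)"
      unfolding x_def using that by (intro sum.mono_neutral_right) auto
    then show ?thesis
      using that by simp
  qed
  have off: "x v = 0" if "v \<notin> S" for v
    using that by (simp add: x_def)
  have "sum x (V i) = 1 / real g" if i: "i \<in> {1..g}" for i
  proof -
    have "sum x (V i) = sum x (S \<inter> V i)"
      using fin[OF i] off by (intro sum.mono_neutral_right) auto
    also have "\<dots> = (\<Sum>v\<in>S \<inter> V i. c i)"
      using x i by (intro sum.cong) auto
    also have "\<dots> = 1 / real g"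
      using meet[OF i] fin[OF i] by (simp add: c_def)
    finally show ?thesis .
  qed
  moreover have "0 \<le> x v" for v
    unfolding x_def using c by (intro sum_nonneg) (auto simp: less_imp_le)
  ultimately show "x \<in> std_cell (blocks g V) S"
    using off by (auto simp: std_cell_def blocks_def)
  show "x v \<noteq> 0" if v: "v \<in> S" for v
  proof -
    obtain i where i: "i \<in> {1..g}" "v \<in> V i"
      using v sub by blast
    then show ?thesis
      using x c v by (metis IntI less_irrefl)
  qed
qed


section \<open>Staircase simplices and couplings supported on chains\<close>

text \<open>Unit steps never decrease a coordinate, so the list of a path is sorted in the product
  order. The second conclusion expresses that a partial path is a chain in this order.\<close>

lemma partial_lattice_path_grid:
  assumes "A \<in> partial_lattice_paths r s"
  shows "A \<subseteq> {1..r} \<times> {1..s}"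
    and "\<And>i j i' j'. (i, j) \<in> A \<Longrightarrow> (i', j') \<in> A \<Longrightarrow> i < i' \<Longrightarrow> j \<le> j'"
proof -
  obtain ps where ps: "A \<subseteq> set ps" "ps \<noteq> []" "hd ps = (1, 1)" "last ps = (r, s)"
    and succ: "successively unit_step ps"
    using assms by (auto simp: partial_lattice_paths_def lattice_paths_def)
  define le where "le p q \<longleftrightarrow> fst p \<le> fst q \<and> snd p \<le> snd q" for p q :: "nat \<times> nat"
  have "successively le ps"
    using succ by (rule successively_mono) (auto simp: unit_step_def le_def)
  then have sorted: "sorted_wrt le ps"
    by (subst (asm) successively_iff_sorted_wrt_strong) (auto simp: le_def)
  have le_nth: "le (ps ! a) (ps ! b)" if "a \<le> b" "b < length ps" for a b
    using sorted_wrt_nth_less[OF sorted, of a b] that by (cases "a = b") (auto simp: le_def)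
  have bounds: "le (1, 1) p" "le p (r, s)" if p: "p \<in> set ps" for p
  proof -
    obtain a where a: "a < length ps" "p = ps ! a"
      using p by (auto simp: in_set_conv_nth)
    then show "le (1, 1) p" "le p (r, s)"
      using le_nth[of 0 a] le_nth[of a "length ps - 1"] ps
      by (auto simp: hd_conv_nth last_conv_nth)
  qed
  then show "A \<subseteq> {1..r} \<times> {1..s}"
    using ps(1) by (fastforce simp: le_def)
  fix i j i' j'
  assume *: "(i, j) \<in> A" "(i', j') \<in> A" "i < i'"
  then obtain a b where ab: "a < length ps" "b < length ps" "ps ! a = (i, j)" "ps ! b = (i', j')"
    using ps(1) by (metis in_set_conv_nth subsetD)
  then show "j \<le> j'"
    using le_nth[of a b] le_nth[of b a] *(3) by (cases "a \<le> b") (auto simp: le_def)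
qed

lemma partial_lattice_paths_subset:
  "A \<in> partial_lattice_paths r s \<Longrightarrow> B \<subseteq> A \<Longrightarrow> B \<in> partial_lattice_paths r s"
  by (auto simp: partial_lattice_paths_def)

lemma finite_partial_lattice_paths: "finite (partial_lattice_paths r s)"
proof (rule finite_subset)
  show "partial_lattice_paths r s \<subseteq> Pow ({1..r} \<times> {1..s})"
    using partial_lattice_path_grid by blast
qed simp

text \<open>The distribution function of a coupling supported on a chain is the minimum of its marginal
  distribution functions, since the support misses one of the quadrants north-west and south-east
  of any given point.\<close>

lemma chain_coupling_cdf:
  fixes u :: "nat \<Rightarrow> nat \<Rightarrow> real"
  assumes nonneg: "\<And>i j. 0 \<le> u i j"
    and chain: "\<And>i j i' j'. u i j \<noteq> 0 \<Longrightarrow> u i' j' \<noteq> 0 \<Longrightarrow> i < i' \<Longrightarrow> j \<le> j'"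
    and "i \<le> m" "j \<le> n"
  shows "(\<Sum>a<i. \<Sum>b<j. u a b) = min (\<Sum>a<i. \<Sum>b<n. u a b) (\<Sum>b<j. \<Sum>a<m. u a b)"
proof -
  have C: "(\<Sum>b<j. \<Sum>a<m. u a b) = (\<Sum>a<m. \<Sum>b<j. u a b)"
    by (rule sum.swap)
  have le1: "(\<Sum>a<i. \<Sum>b<j. u a b) \<le> (\<Sum>a<i. \<Sum>b<n. u a b)"
    using assms by (intro sum_mono sum_mono2) auto
  have le2: "(\<Sum>a<i. \<Sum>b<j. u a b) \<le> (\<Sum>a<m. \<Sum>b<j. u a b)"
    using assms by (intro sum_mono2) (auto intro: sum_nonneg)
  show ?thesis
  proof (cases "\<forall>a<i. \<forall>b. j \<le> b \<longrightarrow> b < n \<longrightarrow> u a b = 0")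
    case True
    then have "(\<Sum>a<i. \<Sum>b<n. u a b) = (\<Sum>a<i. \<Sum>b<j. u a b)"
      using assms by (intro sum.cong sum.mono_neutral_right) auto
    then show ?thesis
      using le2 C by simp
  next
    case False
    then obtain a b where ab: "a < i" "j \<le> b" "u a b \<noteq> 0"
      by auto
    have "u a' b' = 0" if "i \<le> a'" "b' < j" for a' b'
      using chain[OF ab(3), of a' b'] ab that by force
    then have "(\<Sum>a<m. \<Sum>b<j. u a b) = (\<Sum>a<i. \<Sum>b<j. u a b)"
      using assms by (intro sum.mono_neutral_right) auto
    then show ?thesis
      using le1 C by simp
  qed
qed

text \<open>By \<open>chain_coupling_cdf\<close> the marginals fix the distribution function, whose
  mixed second difference returns the single entry.\<close>

lemma chain_coupling_unique:
  fixes u w :: "nat \<Rightarrow> nat \<Rightarrow> real"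
  assumes u: "\<And>i j. 0 \<le> u i j"
      "\<And>i j i' j'. u i j \<noteq> 0 \<Longrightarrow> u i' j' \<noteq> 0 \<Longrightarrow> i < i' \<Longrightarrow> j \<le> j'"
    and w: "\<And>i j. 0 \<le> w i j"
      "\<And>i j i' j'. w i j \<noteq> 0 \<Longrightarrow> w i' j' \<noteq> 0 \<Longrightarrow> i < i' \<Longrightarrow> j \<le> j'"
    and row: "\<And>i. i < m \<Longrightarrow> (\<Sum>j<n. u i j) = (\<Sum>j<n. w i j)"
    and col: "\<And>j. j < n \<Longrightarrow> (\<Sum>i<m. u i j) = (\<Sum>i<m. w i j)"
    and ij: "i < m" "j < n"
  shows "u i j = w i j"
proof -
  have H: "(\<Sum>a<i. \<Sum>b<j. u a b) = (\<Sum>a<i. \<Sum>b<j. w a b)" if "i \<le> m" "j \<le> n" for i j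
    using chain_coupling_cdf[OF u that] chain_coupling_cdf[OF w that] row col that by simp
  have "v i j = (\<Sum>a<Suc i. \<Sum>b<Suc j. v a b) - (\<Sum>a<i. \<Sum>b<Suc j. v a b)
      - (\<Sum>a<Suc i. \<Sum>b<j. v a b) + (\<Sum>a<i. \<Sum>b<j. v a b)" for v :: "nat \<Rightarrow> nat \<Rightarrow> real"
    by simp
  then show ?thesis
    using H ij by (metis Suc_leI less_imp_le)
qed

section \<open>Slices of the staircase triangulation in barycentric coordinates\<close>

definition grid_pt :: "nat \<times> nat \<Rightarrow> (nat \<Rightarrow> real) \<times> (nat \<Rightarrow> real)" where
  "grid_pt p = (unit_vec (fst p), unit_vec (snd p))"

definition grid_row :: "nat \<Rightarrow> nat \<Rightarrow> (nat \<times> nat) set" where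
  "grid_row s i = {i} \<times> {1..s}"

lemma finite_grid_row [simp]: "finite (grid_row s i)"
  by (simp add: grid_row_def)

lemma disjoint_family_grid_row: "disjoint_family_on (grid_row s) I"
  by (auto simp: disjoint_family_on_def grid_row_def)

lemma sum_grid_row: "sum u (grid_row s i) = (\<Sum>j\<in>{1..s}. u (i, j))"
  using sum.cartesian_product[of "\<lambda>i j. u (i, j)" "{1..s}" "{i}"] by (simp add: grid_row_def)

lemma inj_grid_pt: "inj grid_pt"
  by (rule injI) (auto simp: grid_pt_def prod_eq_iff dest: injD[OF inj_unit_vec])

text \<open>The weight of (i, j) counts once towards row i and once towards column j, so a point of
  the product of simplices is the pair of marginals of its barycentric coordinates.\<close>

lemma sum_grid_pt:
  assumes "A \<subseteq> {1..r} \<times> {1..s}" "\<forall>p. p \<notin> A \<longrightarrow> u p = 0"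
  shows "(\<Sum>p\<in>A. u p *\<^sub>R grid_pt p) =
    (\<lambda>i. if i \<in> {1..r} then \<Sum>j\<in>{1..s}. u (i, j) else 0,
     \<lambda>j. if j \<in> {1..s} then \<Sum>i\<in>{1..r}. u (i, j) else 0)"
proof -
  have "(\<Sum>p\<in>A. u p *\<^sub>R grid_pt p) = (\<Sum>p\<in>{1..r} \<times> {1..s}. u p *\<^sub>R grid_pt p)"
    using assms by (intro sum.mono_neutral_left) auto
  also have "\<dots> = (\<Sum>i\<in>{1..r}. \<Sum>j\<in>{1..s}. u (i, j) *\<^sub>R grid_pt (i, j))"
    by (subst sum.cartesian_product) (simp add: case_prod_unfold)
  finally have *: "(\<Sum>p\<in>A. u p *\<^sub>R grid_pt p) = (\<Sum>i\<in>{1..r}. \<Sum>j\<in>{1..s}. u (i, j) *\<^sub>R grid_pt (i, j))" .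
  have 1: "fst (\<Sum>p\<in>A. u p *\<^sub>R grid_pt p) i = (if i \<in> {1..r} then \<Sum>j\<in>{1..s}. u (i, j) else 0)" for i
    unfolding * by (simp add: fst_sum sum_fun_apply grid_pt_def unit_vec_def if_distrib
        sum.delta sum.swap[of _ "{Suc 0..s}"] flip: sum_distrib_right cong: if_cong)
  have 2: "snd (\<Sum>p\<in>A. u p *\<^sub>R grid_pt p) j = (if j \<in> {1..s} then \<Sum>i\<in>{1..r}. u (i, j) else 0)" for j
    unfolding * by (simp add: snd_sum sum_fun_apply grid_pt_def unit_vec_def if_distrib
        sum.delta cong: if_cong)
  show ?thesis
    using 1 2 by (auto simp: prod_eq_iff fun_eq_iff)
qed

definition slice_cell :: "nat \<Rightarrow> nat \<Rightarrow> (nat \<times> nat) set \<Rightarrow> ((nat \<Rightarrow> real) \<times> (nat \<Rightarrow> real)) set" where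
  "slice_cell r s A = convex hull (grid_pt ` A) \<inter>
     ({\<lambda>i. if i \<in> {1..r} then 1 / real r else 0} \<times> coord_space {1..s})"

text \<open>The plane prescribes the first marginal: every row sum is \<open>1 / r\<close>, which is
  membership in \<open>blocks r (grid_row s)\<close>. Adding the r rows gives total mass 1, as the
  convex hull requires.\<close>

lemma slice_cell_eq:
  assumes "A \<subseteq> {1..r} \<times> {1..s}" "0 < r"
  shows "slice_cell r s A = (\<lambda>u. \<Sum>p\<in>A. u p *\<^sub>R grid_pt p) ` std_cell (blocks r (grid_row s)) A"
proof -
  have fin: "finite A"
    using assms finite_subset by blast
  have total: "sum u A = 1" if "u \<in> std_cell (blocks r (grid_row s)) A" for u
  proof -
    have "sum u A = sum u ({1..r} \<times> {1..s})"
      using assms that by (intro sum.mono_neutral_left) (auto simp: std_cell_def)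
    also have "\<dots> = (\<Sum>i\<in>{1..r}. sum u (grid_row s i))"
      by (simp add: sum_grid_row sum.cartesian_product)
    also have "\<dots> = (\<Sum>i\<in>{1..r}. 1 / real r)"
      using that by (intro sum.cong) (auto simp: std_cell_def blocks_def)
    also have "\<dots> = 1"
      using assms(2) by simp
    finally show ?thesis .
  qed
  have hull: "convex hull (grid_pt ` A) = {(\<Sum>a\<in>A. u a *\<^sub>R grid_pt a) | u.
      (\<forall>a. 0 \<le> u a) \<and> (\<forall>a. a \<notin> A \<longrightarrow> u a = 0) \<and> sum u A = 1}"
    using fin inj_on_subset[OF inj_grid_pt subset_UNIV, of A] by (rule convex_hull_image_finite)
  show ?thesis
  proof (intro equalityI subsetI)
    fix z assume z: "z \<in> slice_cell r s A"
    then obtain u where u: "z = (\<Sum>a\<in>A. u a *\<^sub>R grid_pt a)" "\<forall>a. 0 \<le> u a" "\<forall>a. a \<notin> A \<longrightarrow> u a = 0"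
      by (auto simp: slice_cell_def hull)
    have "sum u (grid_row s i) = 1 / real r" if "i \<in> {1..r}" for i
    proof -
      have "fst z i = (if i \<in> {1..r} then 1 / real r else 0)"
        using z by (auto simp: slice_cell_def)
      then show ?thesis
        using that by (simp only: u(1) sum_grid_pt[OF assms(1) u(3)] sum_grid_row fst_conv if_True)
    qed
    then show "z \<in> (\<lambda>u. \<Sum>p\<in>A. u p *\<^sub>R grid_pt p) ` std_cell (blocks r (grid_row s)) A"
      using u by (auto simp: std_cell_def blocks_def)
  next
    fix z assume "z \<in> (\<lambda>u. \<Sum>p\<in>A. u p *\<^sub>R grid_pt p) ` std_cell (blocks r (grid_row s)) A"
    then obtain u where u: "z = (\<Sum>a\<in>A. u a *\<^sub>R grid_pt a)" "u \<in> std_cell (blocks r (grid_row s)) A"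
      by auto
    then have u': "\<forall>a. 0 \<le> u a" "\<forall>a. a \<notin> A \<longrightarrow> u a = 0" "\<forall>i\<in>{1..r}. (\<Sum>j\<in>{1..s}. u (i, j)) = 1 / real r"
      by (auto simp: std_cell_def blocks_def sum_grid_row)
    then have "fst z = (\<lambda>i. if i \<in> {1..r} then 1 / real r else 0)" "snd z \<in> coord_space {1..s}"
      unfolding u(1) sum_grid_pt[OF assms(1) u'(2)] by (auto simp: fun_eq_iff coord_space_def)
    moreover have "z \<in> convex hull (grid_pt ` A)"
      using u u' total unfolding hull by blast
    ultimately show "z \<in> slice_cell r s A"
      unfolding slice_cell_def by (cases z) auto
  qed
qed

text \<open>These paths index the non-empty cells of the slice, because each row has to carry mass
  \<open>1 / r\<close>.\<close>

definition full_paths :: "nat \<Rightarrow> nat \<Rightarrow> (nat \<times> nat) set set" where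
  "full_paths r s = {A \<in> partial_lattice_paths r s. \<forall>i\<in>{1..r}. A \<inter> grid_row s i \<noteq> {}}"

lemma full_paths_full_support:
  assumes "A \<in> full_paths r s"
  obtains u where "u \<in> std_cell (blocks r (grid_row s)) A" "\<And>p. p \<in> A \<Longrightarrow> u p \<noteq> 0"
proof (rule std_cell_blocks_full_support)
  show "A \<subseteq> (\<Union>i\<in>{1..r}. grid_row s i)"
    using assms partial_lattice_path_grid(1)[of A r s] by (auto simp: full_paths_def grid_row_def)
  show "A \<inter> grid_row s i \<noteq> {}" if "i \<in> {1..r}" for i
    using assms that by (auto simp: full_paths_def)
qed (auto simp: disjoint_family_grid_row intro: that)

lemma staircase_slice_eq:
  assumes "0 < r"
  shows "staircase_slice r s = slice_cell r s ` full_paths r s"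
proof -
  have "(\<lambda>(i, j). (unit_vec i, unit_vec j)) = grid_pt"
    by (auto simp: grid_pt_def)
  then have eq: "staircase_slice r s = slice_cell r s ` partial_lattice_paths r s - {{}}"
    unfolding staircase_slice_def staircase_def slice_cell_def by auto
  have "slice_cell r s A \<noteq> {} \<longleftrightarrow> A \<in> full_paths r s" if A: "A \<in> partial_lattice_paths r s" for A
  proof -
    have "slice_cell r s A \<noteq> {} \<longleftrightarrow> std_cell (blocks r (grid_row s)) A \<noteq> {}"
      using slice_cell_eq[OF partial_lattice_path_grid(1)[OF A] assms] by simp
    also have "\<dots> \<longleftrightarrow> A \<in> full_paths r s"
    proof
      assume "std_cell (blocks r (grid_row s)) A \<noteq> {}"
      then show "A \<in> full_paths r s"
        using A std_cell_blocks_meets[of r "grid_row s" A] by (simp add: full_paths_def)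
    next
      assume "A \<in> full_paths r s"
      then show "std_cell (blocks r (grid_row s)) A \<noteq> {}"
        by (rule full_paths_full_support) auto
    qed
    finally show ?thesis .
  qed
  then have "full_paths r s = {A \<in> partial_lattice_paths r s. slice_cell r s A \<noteq> {}}"
    by (auto simp: full_paths_def)
  with eq show ?thesis
    by auto
qed

text \<open>A point of the cell of \<open>A\<close> with full support is the image of a coupling on
  \<open>A\<close>. If it also lies in the cell of \<open>B\<close>, it is the image of a coupling
  on \<open>B\<close> with the same marginals. Both supports are chains, so the couplings agree and
  the support \<open>A\<close> is contained in \<open>B\<close>.\<close>

lemma slice_cell_subset_iff:
  assumes "0 < r" and A: "A \<in> full_paths r s" and B: "B \<in> full_paths r s"
  shows "slice_cell r s A \<subseteq> slice_cell r s B \<longleftrightarrow> A \<subseteq> B"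
proof
  assume sub: "slice_cell r s A \<subseteq> slice_cell r s B"
  have AP: "A \<in> partial_lattice_paths r s" and BP: "B \<in> partial_lattice_paths r s"
    using A B by (auto simp: full_paths_def)
  note gA = partial_lattice_path_grid[OF AP] and gB = partial_lattice_path_grid[OF BP]
  obtain u where u: "u \<in> std_cell (blocks r (grid_row s)) A" "\<And>p. p \<in> A \<Longrightarrow> u p \<noteq> 0"
    using full_paths_full_support[OF A] by blast
  then have "(\<Sum>p\<in>A. u p *\<^sub>R grid_pt p) \<in> slice_cell r s A"
    using gA \<open>0 < r\<close> by (simp add: slice_cell_eq)
  with sub have "(\<Sum>p\<in>A. u p *\<^sub>R grid_pt p) \<in> slice_cell r s B"
    by auto
  then obtain w where w: "w \<in> std_cell (blocks r (grid_row s)) B"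
    and eq: "(\<Sum>p\<in>A. u p *\<^sub>R grid_pt p) = (\<Sum>p\<in>B. w p *\<^sub>R grid_pt p)"
    using gB \<open>0 < r\<close> by (auto simp: slice_cell_eq)
  have offA: "\<forall>p. p \<notin> A \<longrightarrow> u p = 0" and offB: "\<forall>p. p \<notin> B \<longrightarrow> w p = 0"
    using u w by (auto simp: std_cell_def)
  have marg: "(\<Sum>j\<in>{1..s}. u (i, j)) = (\<Sum>j\<in>{1..s}. w (i, j))" if "i \<in> {1..r}" for i
    using arg_cong[OF eq, of "\<lambda>z. fst z i"] that
    by (simp only: sum_grid_pt[OF gA(1) offA] sum_grid_pt[OF gB(1) offB] fst_conv if_True)
  have marg': "(\<Sum>i\<in>{1..r}. u (i, j)) = (\<Sum>i\<in>{1..r}. w (i, j))" if "j \<in> {1..s}" for j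
    using arg_cong[OF eq, of "\<lambda>z. snd z j"] that
    by (simp only: sum_grid_pt[OF gA(1) offA] sum_grid_pt[OF gB(1) offB] snd_conv if_True)
  have "(i, 0) \<notin> A" "(0, i) \<notin> A" "(i, 0) \<notin> B" "(0, i) \<notin> B" for i
    using gA(1) gB(1) by auto
  \<comment> \<open>The uniqueness lemma sums from index 0, the grid starts at 1. The extra row and
    column carry no mass.\<close>
  then have zero: "u (i, 0) = 0" "u (0, i) = 0" "w (i, 0) = 0" "w (0, i) = 0" for i
    using offA offB by auto
  have shift: "(\<Sum>a<Suc n. h a) = (\<Sum>a\<in>{1..n}. h a)" if "h 0 = 0" for h :: "nat \<Rightarrow> real" and n
  proof (rule sum.mono_neutral_right)
    show "\<forall>a\<in>{..<Suc n} - {1..n}. h a = 0"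
      using that by (auto simp: not_le less_Suc_eq_le)
  qed auto
  show "A \<subseteq> B"
  proof
    fix p assume p: "p \<in> A"
    then obtain i j where ij: "p = (i, j)" "i \<in> {1..r}" "j \<in> {1..s}"
      using gA(1) by blast
    have "u (i, j) = w (i, j)"
    proof (rule chain_coupling_unique[where u = "\<lambda>i j. u (i, j)" and w = "\<lambda>i j. w (i, j)"
          and m = "Suc r" and n = "Suc s"])
      show "0 \<le> u (i, j)" "0 \<le> w (i, j)" for i j
        using u w by (auto simp: std_cell_def)
      show "j \<le> j'" if "u (i, j) \<noteq> 0" "u (i', j') \<noteq> 0" "i < i'" for i j i' j'
        using gA(2) offA that by metis
      show "j \<le> j'" if "w (i, j) \<noteq> 0" "w (i', j') \<noteq> 0" "i < i'" for i j i' j'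
        using gB(2) offB that by metis
      show "(\<Sum>b<Suc s. u (a, b)) = (\<Sum>b<Suc s. w (a, b))" if "a < Suc r" for a
        using marg[of a] that zero by (cases "a = 0") (auto simp: shift simp del: sum.lessThan_Suc)
      show "(\<Sum>a<Suc r. u (a, b)) = (\<Sum>a<Suc r. w (a, b))" if "b < Suc s" for b
        using marg'[of b] that zero by (cases "b = 0") (auto simp: shift simp del: sum.lessThan_Suc)
    qed (use ij in auto)
    then show "p \<in> B"
      using u(2)[OF p] offB ij by metis
  qed
next
  assume "A \<subseteq> B"
  then have "convex hull (grid_pt ` A) \<subseteq> convex hull (grid_pt ` B)"
    by (intro hull_mono image_mono)
  then show "slice_cell r s A \<subseteq> slice_cell r s B"
    unfolding slice_cell_def by blast
qed


section \<open>Copies inside projected Hom-complexes\<close>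

lemma simplex_face_subset_iff:
  assumes "finite A" "finite B"
  shows "simplex_face A \<subseteq> simplex_face B \<longleftrightarrow> A \<subseteq> B"
proof
  assume sub: "simplex_face A \<subseteq> simplex_face B"
  show "A \<subseteq> B"
  proof
    fix v assume "v \<in> A"
    then have "unit_vec v \<in> simplex_face A"
      by (simp add: simplex_face_def hull_inc)
    with sub have "unit_vec v \<in> simplex_face B"
      by auto
    then show "v \<in> B"
      using assms by (auto simp: simplex_face_eq unit_vec_def split: if_splits)
  qed
next
  show "simplex_face A \<subseteq> simplex_face B" if "A \<subseteq> B"
    unfolding simplex_face_def using that by (intro hull_mono image_mono)
qed

lemma convex_hull_grid_pt_subset_iff:
  "convex hull (grid_pt ` A) \<subseteq> convex hull (grid_pt ` B) \<longleftrightarrow> A \<subseteq> B"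
proof
  assume sub: "convex hull (grid_pt ` A) \<subseteq> convex hull (grid_pt ` B)"
  show "A \<subseteq> B"
  proof (rule ccontr)
    assume "\<not> A \<subseteq> B"
    then obtain p where p: "p \<in> A" "p \<notin> B"
      by auto
    \<comment> \<open>The sum of these two coordinates is 2 at \<open>grid_pt p\<close> and at most
      1 at every other grid point, so this half-space separates \<open>p\<close> from
      \<open>B\<close>.\<close>
    define S where "S = {z. fst z (fst p) + snd z (snd p) \<le> (1::real)}"
    have "convex S"
    proof (rule convexI)
      fix x y :: "(nat \<Rightarrow> real) \<times> (nat \<Rightarrow> real)" and u w :: real
      assume xy: "x \<in> S" "y \<in> S" and uw: "0 \<le> u" "0 \<le> w" "u + w = 1"
      have "u * (fst x (fst p) + snd x (snd p)) + w * (fst y (fst p) + snd y (snd p)) \<le> u * 1 + w * 1"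
        using xy uw by (intro add_mono mult_left_mono) (auto simp: S_def)
      then show "u *\<^sub>R x + w *\<^sub>R y \<in> S"
        using uw by (simp add: S_def algebra_simps)
    qed
    moreover have "grid_pt ` B \<subseteq> S"
      using p(2) by (auto simp: S_def grid_pt_def unit_vec_def)
    ultimately have "convex hull (grid_pt ` B) \<subseteq> S"
      by (rule hull_minimal[rotated])
    moreover have "grid_pt p \<in> convex hull (grid_pt ` B)"
      using sub p(1) by (meson hull_inc imageI subsetD)
    ultimately show False
      by (auto simp: S_def grid_pt_def unit_vec_def)
  qed
qed (intro hull_mono image_mono)

text \<open>A single colour class may contain crossing diagonals, so \<open>proj_Hom_plus\<close> of all simplices
  is the whole simplex on \<open>V\<close> and no condition on \<open>E\<close> is needed.\<close>

lemma contains_copy_Hom_plus: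
  assumes "0 < g" and inj: "inj_on f ({1..r} \<times> {1..s})" and fV: "f ` ({1..r} \<times> {1..s}) \<subseteq> V"
  shows "contains_copy (proj_Hom_plus g ` Hom_plus g V E) (staircase r s)"
proof -
  let ?G = "{1..r} \<times> {1..s}" and ?P = "partial_lattice_paths r s"
  have sub: "A \<subseteq> ?G" if "A \<in> ?P" for A
    using partial_lattice_path_grid(1)[OF that] .
  then have fin: "finite (f ` A)" if "A \<in> ?P" for A
    using that finite_subset by blast
  have cell: "simplex_face (f ` A) = std_cell (blocks 1 (\<lambda>_. f ` ?G)) (f ` A)" if "A \<in> ?P" for A
    using sub[OF that] by (intro simplex_face_std_cell) auto
  have eq: "(\<lambda>A. simplex_face (f ` A)) ` ?P = std_cell (blocks 1 (\<lambda>_. f ` ?G)) ` ((`) f) ` ?P"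
    using cell by (simp add: image_image)
  have "polytopal_complex ((\<lambda>A. simplex_face (f ` A)) ` ?P)"
    unfolding eq
  proof (rule polytopal_complex_std_cells)
    show "polytope (std_cell (blocks 1 (\<lambda>_. f ` ?G)) A)" if "A \<in> ((`) f) ` ?P" for A
    proof -
      obtain B where "B \<in> ?P" "A = f ` B"
        using \<open>A \<in> ((`) f) ` ?P\<close> by blast
      then show ?thesis
        using polytope_simplex_face[OF fin] by (simp only: flip: cell)
    qed
    show "B \<in> ((`) f) ` ?P" if "A \<in> ((`) f) ` ?P" "B \<subseteq> A" for A B
      using that by (metis (no_types, lifting) imageE imageI partial_lattice_paths_subset subset_imageE)
  qed (use fin in \<open>auto simp: affine_blocks finite_partial_lattice_paths\<close>)
  moreover have "(\<lambda>A. simplex_face (f ` A)) ` ?P \<subseteq> proj_Hom_plus g ` Hom_plus g V E"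
  proof clarify
    fix A assume A: "A \<in> ?P"
    define \<sigma> where "\<sigma> = (\<lambda>i\<in>{1..g}. if i = 1 then f ` A else {})"
    have "\<sigma> \<in> Hom_plus g V E"
      using subset_trans[OF image_mono[OF sub[OF A]] fV] by (auto simp: Hom_plus_def \<sigma>_def)
    moreover have "(\<Union>i\<in>{1..g}. simplex_face (\<sigma> i)) = simplex_face (f ` A)"
      using \<open>0 < g\<close> by (fastforce simp: \<sigma>_def simplex_face_def split: if_splits)
    then have "proj_Hom_plus g \<sigma> = simplex_face (f ` A)"
      by (simp add: proj_Hom_plus_def simplex_face_def)
    ultimately show "simplex_face (f ` A) \<in> proj_Hom_plus g ` Hom_plus g V E"
      by blast
  qed
  moreover have "face_poset_iso ((\<lambda>A. simplex_face (f ` A)) ` ?P)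
      ((\<lambda>A. convex hull (grid_pt ` A)) ` ?P)"
  proof (rule face_poset_isoI)
    show "simplex_face (f ` A) \<subseteq> simplex_face (f ` B) \<longleftrightarrow> A \<subseteq> B" if "A \<in> ?P" "B \<in> ?P" for A B
      using that inj sub fin by (simp add: simplex_face_subset_iff inj_on_image_subset_iff)
  qed (rule convex_hull_grid_pt_subset_iff)
  moreover have "staircase r s = (\<lambda>A. convex hull (grid_pt ` A)) ` ?P"
    by (simp add: staircase_def grid_pt_def case_prod_unfold)
  ultimately show ?thesis
    unfolding contains_copy_def subcomplex_def by metis
qed

text \<open>A cell of \<open>Hom\<close> needs all \<open>g\<close> classes non-empty. One-point
  classes add no faces, and placing them in the last column keeps the padded set a chain.\<close>

definition pad_rows :: "nat \<Rightarrow> nat \<Rightarrow> nat \<Rightarrow> (nat \<times> nat) set \<Rightarrow> (nat \<times> nat) set" where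
  "pad_rows g r s A = A \<union> {r<..g} \<times> {s}"

lemma pad_rows_path:
  assumes "A \<in> full_paths r s" "r \<le> g" "1 \<le> s"
  shows "pad_rows g r s A \<subseteq> {1..g} \<times> {1..s}"
    and "\<And>i j i' j'. (i, j) \<in> pad_rows g r s A \<Longrightarrow> (i', j') \<in> pad_rows g r s A \<Longrightarrow> i < i' \<Longrightarrow> j \<le> j'"
    and "\<And>i. i \<in> {1..g} \<Longrightarrow> pad_rows g r s A \<inter> grid_row s i \<noteq> {}"
proof -
  have A: "A \<in> partial_lattice_paths r s"
    using assms by (auto simp: full_paths_def)
  note grid = partial_lattice_path_grid[OF A]
  show sub: "pad_rows g r s A \<subseteq> {1..g} \<times> {1..s}"
    using assms grid(1) by (auto simp: pad_rows_def)
  show "j \<le> j'" if "(i, j) \<in> pad_rows g r s A" "(i', j') \<in> pad_rows g r s A" "i < i'" for i j i' j'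
  proof (cases "i' \<le> r")
    case True
    with that show ?thesis
      using grid(2)[of i j i' j'] by (auto simp: pad_rows_def)
  next
    case False
    then have "j' = s"
      using that grid(1) by (auto simp: pad_rows_def)
    then show ?thesis
      using sub that by auto
  qed
  show "pad_rows g r s A \<inter> grid_row s i \<noteq> {}" if "i \<in> {1..g}" for i
  proof (cases "i \<le> r")
    case True
    then have "A \<inter> grid_row s i \<noteq> {}"
      using assms that by (auto simp: full_paths_def)
    then show ?thesis
      by (auto simp: pad_rows_def)
  next
    case False
    then have "(i, s) \<in> pad_rows g r s A \<inter> grid_row s i"
      using assms that by (auto simp: pad_rows_def grid_row_def)
    then show ?thesis
      by blast
  qed
qed

lemma contains_copy_Hom:
  assumes r: "0 < r" "r \<le> g" and s: "1 \<le> s"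
    and inj: "inj_on f ({1..g} \<times> {1..s})" and fV: "f ` ({1..g} \<times> {1..s}) \<subseteq> V"
    and E: "\<And>i j i' j'. 1 \<le> i \<Longrightarrow> i < i' \<Longrightarrow> i' \<le> g \<Longrightarrow> 1 \<le> j \<Longrightarrow> j \<le> j' \<Longrightarrow> j' \<le> s \<Longrightarrow>
      E (f (i, j)) (f (i', j')) \<and> E (f (i', j')) (f (i, j))"
  shows "contains_copy (proj_Hom g ` Hom g V E) (staircase_slice r s)"
proof -
  let ?F = "full_paths r s" and ?pad = "pad_rows g r s" and ?G = "{1..g} \<times> {1..s}"
  define Vb where "Vb i = f ` grid_row s i" for i
  define C where "C A = std_cell (blocks g Vb) (f ` ?pad A)" for A
  note pad = pad_rows_path[OF _ r(2) s]
  have row_G: "grid_row s i \<subseteq> ?G" if "i \<in> {1..g}" for i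
    using that by (auto simp: grid_row_def)
  have disj: "disjoint_family_on Vb {1..g}"
    unfolding disjoint_family_on_def Vb_def
  proof (intro ballI impI)
    fix i j assume "i \<in> {1..g}" "j \<in> {1..g}" "i \<noteq> j"
    then show "f ` grid_row s i \<inter> f ` grid_row s j = {}"
      using inj_on_image_Int[OF inj row_G row_G, of i j] by (auto simp: grid_row_def)
  qed
  have finVb: "finite (Vb i)" for i
    by (simp add: Vb_def)
  have finpad: "finite (?pad A)" if "A \<in> ?F" for A
    using pad(1)[OF that] finite_subset by blast
  have image_row: "f ` ?pad A \<inter> Vb i = f ` (?pad A \<inter> grid_row s i)" if "A \<in> ?F" "i \<in> {1..g}" for A i
    using inj_on_image_Int[OF inj pad(1)[OF that(1)] row_G[OF that(2)]] by (simp add: Vb_def)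
  define \<sigma> where "\<sigma> A = (\<lambda>i\<in>{1..g}. f ` (?pad A \<inter> grid_row s i))" for A
  have proj: "proj_Hom g (\<sigma> A) = C A" if A: "A \<in> ?F" for A
  proof -
    have "?pad A = (\<Union>i\<in>{1..g}. ?pad A \<inter> grid_row s i)"
      using pad(1)[OF A] by (auto simp: grid_row_def)
    then have "f ` ?pad A = (\<Union>i\<in>{1..g}. f ` (?pad A \<inter> grid_row s i))"
      by (metis image_UN)
    then have "(\<Union>i\<in>{1..g}. \<sigma> A i) = f ` ?pad A"
      by (simp add: \<sigma>_def)
    moreover have "proj_Hom g (\<sigma> A) = std_cell (blocks g Vb) (\<Union>i\<in>{1..g}. \<sigma> A i)"
      using r finVb disj by (intro proj_Hom_std_cell) (auto simp: \<sigma>_def Vb_def)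
    ultimately show ?thesis
      by (simp add: C_def)
  qed
  have Hom: "\<sigma> A \<in> Hom g V E" if A: "A \<in> ?F" for A
  proof -
    have "E (f p) (f q)" if "p \<in> ?pad A" "q \<in> ?pad A" "fst p \<noteq> fst q" for p q
    proof -
      have "p \<in> ?G" "q \<in> ?G"
        using pad(1)[OF A] that by auto
      moreover have "fst p < fst q \<Longrightarrow> snd p \<le> snd q" "fst q < fst p \<Longrightarrow> snd q \<le> snd p"
        using pad(2)[OF A] that by (metis prod.collapse)+
      ultimately show ?thesis
        using E[of "fst p" "fst q" "snd p" "snd q"] E[of "fst q" "fst p" "snd q" "snd p"] that(3)
        by (cases "fst p < fst q") auto
    qed
    then have "E u v" if "i \<in> {1..g}" "j \<in> {1..g}" "i \<noteq> j" "u \<in> \<sigma> A i" "v \<in> \<sigma> A j" for i j u v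
      using that by (auto simp: \<sigma>_def grid_row_def)
    moreover have "\<sigma> A i \<in> Pow V - {{}}" if "i \<in> {1..g}" for i
      using pad(3)[OF A that] row_G[OF that] fV that by (auto simp: \<sigma>_def)
    moreover have "\<sigma> A \<in> extensional {1..g}"
      by (simp add: \<sigma>_def)
    ultimately show ?thesis
      unfolding Hom_def by (auto simp: PiE_def)
  qed
  have "polytopal_complex (std_cell (blocks g Vb) ` (\<lambda>A. f ` ?pad A) ` ?F)"
  proof (rule polytopal_complex_std_cells)
    show "finite ((\<lambda>A. f ` ?pad A) ` ?F)"
      using finite_partial_lattice_paths by (simp add: full_paths_def)
    show "finite S" if "S \<in> (\<lambda>A. f ` ?pad A) ` ?F" for S
      using that finpad by auto
    show "polytope (std_cell (blocks g Vb) S)" if S: "S \<in> (\<lambda>A. f ` ?pad A) ` ?F" for S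
    proof -
      obtain A where A: "A \<in> ?F" "S = f ` ?pad A"
        using S by auto
      have "polytope (proj_Hom g (\<sigma> A))"
        using finpad[OF A(1)] by (intro polytope_proj_Hom) (auto simp: \<sigma>_def)
      then show ?thesis
        using proj[OF A(1)] A(2) by (simp add: C_def)
    qed
    show "B \<in> (\<lambda>A. f ` ?pad A) ` ?F"
      if S: "S \<in> (\<lambda>A. f ` ?pad A) ` ?F" and BS: "B \<subseteq> S" and ne: "std_cell (blocks g Vb) B \<noteq> {}" for S B
    proof -
      obtain A where A: "A \<in> ?F" "S = f ` ?pad A"
        using S by auto
      define A' where "A' = {p \<in> A. f p \<in> B}"
      have meets: "\<exists>p \<in> ?pad A \<inter> grid_row s i. f p \<in> B" if i: "i \<in> {1..g}" for i
      proof -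
        obtain w where "w \<in> B" "w \<in> Vb i"
          using std_cell_blocks_meets[OF ne i] by blast
        moreover from this have "w \<in> f ` (?pad A \<inter> grid_row s i)"
          using image_row[OF A(1) i] A(2) BS by blast
        ultimately show ?thesis
          by auto
      qed
      have gridA: "A \<subseteq> {1..r} \<times> {1..s}"
        using A(1) partial_lattice_path_grid(1)[of A r s] by (auto simp: full_paths_def)
      have "A' \<in> ?F"
        unfolding full_paths_def
      proof (intro CollectI conjI ballI)
        show "A' \<in> partial_lattice_paths r s"
          using A(1) partial_lattice_paths_subset[of A r s A'] by (auto simp: full_paths_def A'_def)
        fix i assume i: "i \<in> {1..r}"
        then obtain p where "p \<in> ?pad A" "p \<in> grid_row s i" "f p \<in> B"
          using meets[of i] r(2) by auto
        moreover from this have "p \<in> A"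
          using i by (auto simp: pad_rows_def grid_row_def)
        ultimately show "A' \<inter> grid_row s i \<noteq> {}"
          by (auto simp: A'_def)
      qed
      moreover have "B = f ` ?pad A'"
      proof
        show "B \<subseteq> f ` ?pad A'"
          using BS A(2) by (auto simp: A'_def pad_rows_def)
        \<comment> \<open>Beyond row r the padded set has a single point per row, which a support
          meeting all blocks cannot drop.\<close>
        have "f (i, s) \<in> B" if i: "i \<in> {r<..g}" for i
        proof -
          obtain p where p: "p \<in> ?pad A" "p \<in> grid_row s i" "f p \<in> B"
            using meets[of i] i by auto
          then have "p = (i, s)"
            using i gridA by (auto simp: pad_rows_def grid_row_def)
          with p show ?thesis
            by simp
        qed
        then show "f ` ?pad A' \<subseteq> B"
          by (auto simp: A'_def pad_rows_def)
      qed
      ultimately show ?thesis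
        by blast
    qed
  qed (rule affine_blocks)
  then have "polytopal_complex (C ` ?F)"
    by (simp add: C_def image_image)
  moreover have "C ` ?F \<subseteq> proj_Hom g ` Hom g V E"
    using proj Hom by (metis (no_types, lifting) image_eqI image_subsetI)
  moreover have "face_poset_iso (C ` ?F) (slice_cell r s ` ?F)"
  proof (rule face_poset_isoI)
    fix A B assume A: "A \<in> ?F" and B: "B \<in> ?F"
    have "f ` ?pad A \<subseteq> (\<Union>i\<in>{1..g}. Vb i)"
      using pad(1)[OF A] by (fastforce simp: Vb_def grid_row_def)
    moreover have "f ` ?pad A \<inter> Vb i \<noteq> {}" if "i \<in> {1..g}" for i
      using image_row[OF A that] pad(3)[OF A that] by simp
    ultimately obtain x where "x \<in> std_cell (blocks g Vb) (f ` ?pad A)"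
        "\<And>v. v \<in> f ` ?pad A \<Longrightarrow> x v \<noteq> 0"
      using std_cell_blocks_full_support[OF finVb disj] by blast
    then have "C A \<subseteq> C B \<longleftrightarrow> f ` ?pad A \<subseteq> f ` ?pad B"
      unfolding C_def by (rule std_cell_subset_iff)
    also have "\<dots> \<longleftrightarrow> ?pad A \<subseteq> ?pad B"
      using inj_on_image_subset_iff[OF inj pad(1)[OF A] pad(1)[OF B]] .
    also have "\<dots> \<longleftrightarrow> A \<subseteq> B"
    proof -
      have "A \<inter> {r<..g} \<times> {s} = {}"
        using A partial_lattice_path_grid(1)[of A r s] by (force simp: full_paths_def)
      then show ?thesis
        unfolding pad_rows_def by blast
    qed
    finally show "C A \<subseteq> C B \<longleftrightarrow> A \<subseteq> B" .
    show "slice_cell r s A \<subseteq> slice_cell r s B \<longleftrightarrow> A \<subseteq> B"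
      using slice_cell_subset_iff[OF r(1) A B] .
  qed
  ultimately show ?thesis
    unfolding contains_copy_def subcomplex_def staircase_slice_eq[OF r(1)] by blast
qed


section \<open>Convex polygons\<close>

text \<open>Twice the signed area of the triangle, positive when a, b, c turn
  counterclockwise.\<close>

definition orient :: "real^2 \<Rightarrow> real^2 \<Rightarrow> real^2 \<Rightarrow> real" where
  "orient a b c = (b$1 - a$1) * (c$2 - a$2) - (b$2 - a$2) * (c$1 - a$1)"

definition left_normal :: "real^2 \<Rightarrow> real^2 \<Rightarrow> real^2" where
  "left_normal a b = vector [a$2 - b$2, b$1 - a$1]"

text \<open>This makes the half-space and supporting-hyperplane lemmas applicable to signed
  areas.\<close>

lemma orient_inner: "orient a b x = left_normal a b \<bullet> x - left_normal a b \<bullet> a"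
  by (simp add: orient_def left_normal_def inner_vec_def sum_2 algebra_simps)

lemma left_normal_nonzero: "a \<noteq> b \<Longrightarrow> left_normal a b \<noteq> 0"
  by (auto simp: left_normal_def vec_eq_iff forall_2)

lemma orient_same [simp]: "orient a b a = 0" "orient a b b = 0" "orient a a b = 0"
  by (simp_all add: orient_def)

lemma orient_rotate: "orient a b c = orient b c a"
  by (simp add: orient_def algebra_simps)

lemma orient_swap: "orient a b c = - orient a c b"
  by (simp add: orient_def algebra_simps)

lemma orient_combination: "orient a b ((1 - t) *\<^sub>R x + t *\<^sub>R y) = (1 - t) * orient a b x + t * orient a b y"
  by (simp add: orient_def algebra_simps)

lemma orient_add: "orient d b c + orient a d c + orient a b d = orient a b c"
  by (simp add: orient_def algebra_simps)

text \<open>Cramer's rule: barycentric coordinates are quotients of signed areas.\<close>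

lemma in_triangle:
  assumes "0 < orient a b c" "0 \<le> orient d b c" "0 \<le> orient a d c" "0 \<le> orient a b d"
  shows "d \<in> convex hull {a, b, c}"
proof -
  define D where "D = orient a b c"
  have D: "0 < D" "orient d b c + orient a d c + orient a b d = D"
    using assms orient_add by (simp_all add: D_def)
  have cramer: "orient d b c *\<^sub>R a + orient a d c *\<^sub>R b + orient a b d *\<^sub>R c = D *\<^sub>R d"
    by (simp add: vec_eq_iff forall_2 D_def orient_def algebra_simps)
  have "d = (1 / D) *\<^sub>R (D *\<^sub>R d)"
    using D by simp
  also have "\<dots> = (orient d b c / D) *\<^sub>R a + (orient a d c / D) *\<^sub>R b + (orient a b d / D) *\<^sub>R c"
    by (simp add: scaleR_add_right flip: cramer)
  moreover have "orient d b c / D + orient a d c / D + orient a b d / D = 1"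
    using D by (simp flip: add_divide_distrib)
  ultimately show ?thesis
    using assms D(1) unfolding convex_hull_3 by fastforce
qed

lemma orient_eq_0_imp_collinear:
  assumes "orient a b c = 0"
  shows "collinear {a, b, c}"
proof (cases "a = b")
  case False
  \<comment> \<open>The coefficient is that of the orthogonal projection of \<open>c - a\<close>
    onto the line spanned by \<open>b - a\<close>.\<close>
  have "c = ((b - a) \<bullet> (c - a) / ((b - a) \<bullet> (b - a))) *\<^sub>R (b - a) + a"
  proof -
    have nz: "(b - a) \<bullet> (b - a) \<noteq> 0"
      using False by simp
    have "((b - a) \<bullet> (b - a)) *\<^sub>R (c - a) = ((b - a) \<bullet> (c - a)) *\<^sub>R (b - a)"
      using assms by (simp add: vec_eq_iff forall_2 orient_def inner_vec_def sum_2) algebra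
    then have "c - a = ((b - a) \<bullet> (c - a) / ((b - a) \<bullet> (b - a))) *\<^sub>R (b - a)"
      using nz by (metis (no_types, lifting) divide_inverse_commute scaleR_scaleR scaleR_one left_inverse)
    then show ?thesis
      by (simp add: algebra_simps)
  qed
  then obtain t where "c = t *\<^sub>R (b - a) + a"
    by blast
  then have "c = t *\<^sub>R b + (1 - t) *\<^sub>R a"
    by (simp add: algebra_simps)
  then have "collinear {b, c, a}"
    by (auto simp: collinear_3_expand)
  then show ?thesis
    by (simp add: insert_commute)
qed simp

lemma collinear_imp_orient_eq_0:
  assumes "collinear {a, b, c}"
  shows "orient a b c = 0"
proof (cases "a = c")
  case False
  then obtain u where b: "b = u *\<^sub>R a + (1 - u) *\<^sub>R c"
    using assms by (auto simp: collinear_3_expand)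
  show ?thesis
    unfolding b by (simp add: orient_def algebra_simps)
qed simp

text \<open>One of three collinear points lies between the other two, and an extreme point can do so
  only by coinciding with one of them.\<close>

lemma extreme_points_on_line:
  assumes a: "a extreme_point_of P" and b: "b extreme_point_of P" and "a \<noteq> b"
    and z: "z \<in> P" "orient a b z = 0"
  shows "z \<in> closed_segment a b"
proof -
  have aP: "a \<in> P" "\<And>x y. x \<in> P \<Longrightarrow> y \<in> P \<Longrightarrow> a \<notin> open_segment x y"
    and bP: "b \<in> P" "\<And>x y. x \<in> P \<Longrightarrow> y \<in> P \<Longrightarrow> b \<notin> open_segment x y"
    using a b by (auto simp: extreme_point_of_def)
  consider "a \<in> closed_segment b z" | "b \<in> closed_segment z a" | "z \<in> closed_segment a b"
    using orient_eq_0_imp_collinear[OF z(2)] by (auto simp: collinear_between_cases between_mem_segment)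
  then show ?thesis
  proof cases
    case 1
    then show ?thesis
      using aP(2)[OF bP(1) z(1)] \<open>a \<noteq> b\<close> by (auto simp: open_segment_def)
  next
    case 2
    then show ?thesis
      using bP(2)[OF z(1) aP(1)] \<open>a \<noteq> b\<close> by (auto simp: open_segment_def)
  qed
qed

lemma orient_extreme_nonzero:
  assumes "a extreme_point_of P" "b extreme_point_of P" "c extreme_point_of P"
    and "a \<noteq> b" "a \<noteq> c" "b \<noteq> c"
  shows "orient a b c \<noteq> 0"
proof
  assume "orient a b c = 0"
  then have "c \<in> closed_segment a b"
    using assms extreme_points_on_line extreme_point_of_def by metis
  then have "c \<in> open_segment a b"
    using assms by (auto simp: open_segment_def)
  then show False
    using assms by (auto simp: extreme_point_of_def)
qed

lemma extreme_not_in_triangle: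
  assumes "convex P" "d extreme_point_of P" "{a, b, c} \<subseteq> P - {d}"
  shows "d \<notin> convex hull {a, b, c}"
proof -
  have "convex (P - {d})"
    using assms extreme_point_of_stillconvex by blast
  then have "convex hull {a, b, c} \<subseteq> P - {d}"
    using assms(3) by (rule hull_minimal[rotated])
  then show ?thesis
    by auto
qed

text \<open>Otherwise a, b, c would surround o', which would then lie in their triangle, impossible
  for an extreme point. Hence the angular order around an extreme point is transitive.\<close>

lemma orient_extreme_trans:
  assumes "convex P" and ex: "{o', a, b, c} \<subseteq> {x. x extreme_point_of P}"
    and "0 < orient o' a b" "0 < orient o' b c"
  shows "a = c \<or> 0 < orient o' a c"
proof (rule ccontr)
  assume *: "\<not> (a = c \<or> 0 < orient o' a c)"
  have dist: "o' \<noteq> a" "o' \<noteq> b" "o' \<noteq> c"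
    using assms(3,4) by auto
  then have "orient o' a c < 0"
    using orient_extreme_nonzero[of o' P a c] ex * by force
  then have pos: "0 < orient o' b c" "0 < orient a o' c" "0 < orient a b o'"
    using assms(3,4) orient_rotate orient_swap by (metis neg_0_less_iff_less)+
  then have "0 < orient a b c"
    using orient_add[of o' b c a] by linarith
  then have "o' \<in> convex hull {a, b, c}"
    using pos by (intro in_triangle) auto
  then show False
    using extreme_not_in_triangle[of P o' a b c] assms(1) ex dist by (auto simp: extreme_point_of_def)
qed

text \<open>If the turn at b went the other way, b would lie in the triangle o', a, c.\<close>

lemma orient_extreme_fan:
  assumes "convex P" and ex: "{o', a, b, c} \<subseteq> {x. x extreme_point_of P}"
    and "0 < orient o' a b" "0 < orient o' b c" "0 < orient o' a c"
  shows "0 < orient a b c"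
proof (rule ccontr)
  assume *: "\<not> 0 < orient a b c"
  have dist: "o' \<noteq> a" "o' \<noteq> b" "o' \<noteq> c" "a \<noteq> b" "a \<noteq> c" "b \<noteq> c"
    using assms(3-) by auto
  have "0 \<le> orient b a c"
    using * orient_rotate orient_swap by (metis neg_0_le_iff_le not_less)
  then have "b \<in> convex hull {o', a, c}"
    using assms(3-) by (intro in_triangle) auto
  then show False
    using extreme_not_in_triangle[of P b o' a c] assms(1) ex dist by (auto simp: extreme_point_of_def)
qed

text \<open>The vertices are numbered by their angular rank as seen from one of them.\<close>

lemma ccw_labelling:
  fixes X :: "(real^2) set"
  assumes "convex P" and X: "X = {x. x extreme_point_of P}" and "finite X" "X \<noteq> {}"
  obtains v where "v ` {1..card X} = X" "inj_on v {1..card X}"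
    "\<And>a b c. 1 \<le> a \<Longrightarrow> a < b \<Longrightarrow> b < c \<Longrightarrow> c \<le> card X \<Longrightarrow> 0 < orient (v a) (v b) (v c)"
proof -
  obtain o' where o': "o' \<in> X"
    using assms by auto
  define Y where "Y = X - {o'}"
  define below where "below y = {z \<in> Y. 0 < orient o' z y}" for y
  \<comment> \<open>The base point takes label 1. A vertex with no predecessor has rank 0 and takes
    label 2.\<close>
  define idx where "idx y = (if y = o' then 1 else card (below y) + 2)" for y
  have fin: "finite Y" "\<And>y. finite (below y)"
    using assms by (auto simp: Y_def below_def)
  have mono: "card (below y) < card (below y')" if y: "y \<in> Y" "y' \<in> Y" "0 < orient o' y y'" for y y'
  proof (rule psubset_card_mono[OF fin(2)])
    have "z \<in> below y'" if z: "z \<in> below y" for z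
    proof -
      have "z = y' \<or> 0 < orient o' z y'"
        using orient_extreme_trans[OF assms(1), of o' z y y'] z y o' X by (auto simp: below_def Y_def)
      moreover have "z \<noteq> y'"
        using z y orient_swap[of o' y y'] by (auto simp: below_def)
      ultimately show ?thesis
        using z by (auto simp: below_def)
    qed
    moreover have "y \<in> below y'" "y \<notin> below y"
      using y by (auto simp: below_def)
    ultimately show "below y \<subset> below y'"
      by auto
  qed
  have total: "0 < orient o' y y' \<or> 0 < orient o' y' y" if "y \<in> Y" "y' \<in> Y" "y \<noteq> y'" for y y'
    using orient_extreme_nonzero[of o' P y y'] orient_swap[of o' y y'] that o' X
    by (auto simp: Y_def)
  have inj: "inj_on idx X"
  proof (rule inj_onI)
    fix x y assume xy: "x \<in> X" "y \<in> X" "idx x = idx y"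
    show "x = y"
    proof (rule ccontr)
      assume "x \<noteq> y"
      then have "x \<in> Y" "y \<in> Y"
        using xy by (auto simp: Y_def idx_def split: if_splits)
      then show False
        using total[of x y] mono[of x y] mono[of y x] \<open>x \<noteq> y\<close> xy(3)
        by (auto simp: idx_def Y_def)
    qed
  qed
  have range: "idx ` X \<subseteq> {1..card X}"
  proof clarify
    fix y assume y: "y \<in> X"
    have "0 < card X"
      using assms by (simp add: card_gt_0_iff)
    moreover have "card (below y) + 2 \<le> card X" if "y \<noteq> o'"
    proof -
      have "y \<in> Y"
        using y that by (simp add: Y_def)
      moreover have "below y \<subseteq> Y" "y \<notin> below y"
        by (simp_all add: below_def)
      ultimately have "below y \<subset> Y"
        by blast
      then have "card (below y) < card Y"
        using fin(1) by (rule psubset_card_mono[rotated])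
      moreover have "card Y = card X - 1"
        using o' \<open>finite X\<close> by (simp add: Y_def)
      ultimately show ?thesis
        by simp
    qed
    ultimately show "idx y \<in> {1..card X}"
      by (auto simp: idx_def)
  qed
  have bij: "idx ` X = {1..card X}"
    using range by (rule card_subset_eq[OF finite_atLeastAtMost]) (simp add: card_image inj)
  define v where "v = inv_into X idx"
  have v: "v i \<in> X" "idx (v i) = i" if "i \<in> {1..card X}" for i
    using that bij by (auto simp: v_def inv_into_into f_inv_into_f)
  have up: "0 < orient o' (v b) (v c)" if bc: "1 < b" "b < c" "c \<le> card X" for b c
  proof -
    have idx: "idx (v b) = b" "idx (v c) = c" and X: "v b \<in> X" "v c \<in> X"
      using v[of b] v[of c] bc by auto
    have "v b \<noteq> v c"
      using idx bc by auto
    moreover have "v b \<noteq> o'" "v c \<noteq> o'"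
      using idx bc by (auto simp: idx_def split: if_splits)
    moreover from this have "v b \<in> Y" "v c \<in> Y"
      using X by (auto simp: Y_def)
    moreover have "idx (v b) < idx (v c)"
      using idx bc by simp
    ultimately have "v b \<in> Y" "v c \<in> Y" "v b \<noteq> v c" "card (below (v b)) < card (below (v c))"
      by (simp_all add: idx_def)
    then show ?thesis
      using total[of "v b" "v c"] mono[of "v c" "v b"] by linarith
  qed
  show thesis
  proof
    show "v ` {1..card X} = X"
      unfolding v_def bij[symmetric] using inj by (simp add: image_image)
    show "inj_on v {1..card X}"
      using v(2) by (metis inj_onI)
    fix a b c assume abc: "1 \<le> a" "a < b" "b < c" "c \<le> card X"
    show "0 < orient (v a) (v b) (v c)"
    proof (cases "a = 1")
      case True
      have "idx (v a) = 1"
        using v(2)[of a] True abc by simp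
      then have "v a = o'"
        by (simp add: idx_def split: if_splits)
      moreover have "0 < orient o' (v b) (v c)"
        using up abc True by simp
      ultimately show ?thesis
        by simp
    next
      case False
      \<comment> \<open>Triples that avoid the base point inherit their orientation from the three
        fan triangles at it.\<close>
      have "{o', v a, v b, v c} \<subseteq> X"
        using v(1) abc o' by simp
      moreover have "0 < orient o' (v a) (v b)" "0 < orient o' (v b) (v c)" "0 < orient o' (v a) (v c)"
        using up abc False by simp_all
      ultimately show ?thesis
        using orient_extreme_fan[OF assms(1), of o' "v a" "v b" "v c"] X by simp
    qed
  qed
qed

section \<open>Polygons with vertices numbered counterclockwise\<close>

locale labelled_polygon =
  fixes N :: nat and v :: "nat \<Rightarrow> real^2" and P :: "(real^2) set"
  assumes vertices_P: "vertices P = v ` {1..N}"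
    and inj_v: "inj_on v {1..N}"
    and ccw: "\<And>a b c. 1 \<le> a \<Longrightarrow> a < b \<Longrightarrow> b < c \<Longrightarrow> c \<le> N \<Longrightarrow> 0 < orient (v a) (v b) (v c)"
    and P_hull: "P = convex hull (v ` {1..N})"

lemma convex_gon_labelling:
  assumes P: "convex_gon N P" "0 < N"
  obtains v where "labelled_polygon N v P"
proof -
  have poly: "polytope P" "card (vertices P) = N"
    using P by (auto simp: convex_gon_def)
  have fin: "finite (vertices P)" "vertices P \<noteq> {}"
    using poly(2) P(2) by (auto intro: card_ge_0_finite)
  obtain v where v: "v ` {1..N} = vertices P" "inj_on v {1..N}"
    "\<And>a b c. 1 \<le> a \<Longrightarrow> a < b \<Longrightarrow> b < c \<Longrightarrow> c \<le> N \<Longrightarrow> 0 < orient (v a) (v b) (v c)"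
    using ccw_labelling[OF polytope_imp_convex[OF poly(1)] vertices_def fin] poly(2) by metis
  have "P = convex hull (vertices P)"
    unfolding vertices_def
    using poly(1) by (intro Krein_Milman_Minkowski polytope_imp_compact polytope_imp_convex)
  with v have "labelled_polygon N v P"
    by unfold_locales auto
  then show thesis
    by (rule that)
qed

lemma orient_open_segment_neg:
  assumes "orient a b x \<le> 0" "orient a b y \<le> 0" "orient a b x < 0 \<or> orient a b y < 0"
    and "z \<in> open_segment x y"
  shows "orient a b z < 0"
proof -
  obtain t where t: "0 < t" "t < 1" "z = (1 - t) *\<^sub>R x + t *\<^sub>R y"
    using assms(4) by (auto simp: in_segment)
  have "(1 - t) * orient a b x \<le> 0" "t * orient a b y \<le> 0"
    using t assms by (auto intro: mult_nonneg_nonpos)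
  moreover have "(1 - t) * orient a b x < 0 \<or> t * orient a b y < 0"
    using t assms(3) by (auto intro: mult_pos_neg)
  ultimately show ?thesis
    by (auto simp: t(3) orient_combination)
qed

lemma orient_closed_segment:
  assumes "z \<in> closed_segment a b"
  shows "orient a b z = 0"
  using assms by (auto simp: in_segment orient_combination)

lemma convex_orient_halfplanes: "convex {x. orient a b x \<le> 0}" "convex {x. 0 \<le> orient a b x}"
  using convex_halfspace_le[of "left_normal a b" "left_normal a b \<bullet> a"]
    convex_halfspace_ge[of "left_normal a b \<bullet> a" "left_normal a b"]
  by (simp_all add: orient_inner)

lemma interior_orient_halfplanes:
  assumes "a \<noteq> b"
  shows "interior {x. orient a b x \<le> 0} = {x. orient a b x < 0}"
    and "interior {x. 0 \<le> orient a b x} = {x. 0 < orient a b x}"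
  using interior_halfspace_le[OF left_normal_nonzero[OF assms], of "left_normal a b \<bullet> a"]
    interior_halfspace_ge[OF left_normal_nonzero[OF assms], of "left_normal a b \<bullet> a"]
  by (simp_all add: orient_inner)

lemma crosses_line:
  assumes "orient a b y \<le> 0" "0 \<le> orient a b z"
  obtains w where "w \<in> closed_segment y z" "orient a b w = 0"
  using connected_ivt_hyperplane[OF connected_segment(1)[of y z] ends_in_segment(1,2),
      of "left_normal a b" "left_normal a b \<bullet> a"] assms
  by (auto simp: orient_inner)

text \<open>Selects an index by its rank: to find three vertices of a subpolygon, and to find the
  place where a k-gon is cut off.\<close>

lemma ex_element_with_rank:
  fixes I :: "nat set"
  assumes "finite I" "1 \<le> n" "n \<le> card I"
  obtains p where "p \<in> I" "card (I \<inter> {..p}) = n"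
proof -
  have "\<exists>p\<in>I. card (I \<inter> {..p}) = n"
    using assms
  proof (induction I rule: finite_linorder_max_induct)
    case (insert b A)
    have b: "b \<notin> A"
      using insert by auto
    show ?case
    proof (cases "n \<le> card A")
      case True
      then obtain p where p: "p \<in> A" "card (A \<inter> {..p}) = n"
        using insert by auto
      moreover have "insert b A \<inter> {..p} = A \<inter> {..p}"
        using insert.hyps p by auto
      ultimately show ?thesis
        by (intro bexI[of _ p]) simp_all
    next
      case False
      then have "n = card (insert b A)"
        using insert b by simp
      moreover have "insert b A \<inter> {..b} = insert b A"
        using insert.hyps by auto
      ultimately show ?thesis
        by (intro bexI[of _ b]) simp_all
    qed
  qed simp
  with that show thesis
    by blast
qed

text \<open>The numbers of pieces add up only if the two families are disjoint. A common piece would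
  have its interior inside both interiors, but a piece of affine dimension 2 has non-empty
  interior.\<close>

lemma dissection_Un:
  assumes D1: "dissection k m1 P1 \<Q>1" and D2: "dissection k m2 P2 \<Q>2"
    and P: "P = P1 \<union> P2" and int: "interior P1 \<inter> interior P2 = {}"
    and V: "vertices P1 \<subseteq> vertices P" "vertices P2 \<subseteq> vertices P"
  shows "dissection k (m1 + m2) P (\<Q>1 \<union> \<Q>2)"
proof -
  note D1' = D1[unfolded dissection_def] and D2' = D2[unfolded dissection_def]
  have sub: "Q \<subseteq> P1" if "Q \<in> \<Q>1" for Q
    using that D1 by (auto simp: dissection_def)
  have sub': "Q \<subseteq> P2" if "Q \<in> \<Q>2" for Q
    using that D2 by (auto simp: dissection_def)
  have disj: "interior Q \<inter> interior R = {}" if "Q \<in> \<Q>1" "R \<in> \<Q>2" for Q R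
    using interior_mono[OF sub[OF that(1)]] interior_mono[OF sub'[OF that(2)]] int by blast
  have "interior Q \<noteq> {}" if "Q \<in> \<Q>1" for Q
  proof -
    have "convex_gon k Q"
      using that D1 by (auto simp: dissection_def)
    then have "convex Q" "aff_dim Q = int DIM(real^2)"
      by (auto simp: convex_gon_def polytope_imp_convex)
    then show ?thesis
      by (metis aff_dim_empty aff_dim_eq_full aff_dim_le_DIM rel_interior_eq_empty rel_interior_interior
          UNIV_not_empty affine_hull_empty)
  qed
  then have "\<Q>1 \<inter> \<Q>2 = {}"
    using disj by fastforce
  then have "card (\<Q>1 \<union> \<Q>2) = m1 + m2"
    using D1 D2 by (auto simp: dissection_def card_Un_disjoint)
  moreover have "convex_gon k Q \<and> vertices Q \<subseteq> vertices P" if Q: "Q \<in> \<Q>1 \<union> \<Q>2" for Q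
  proof -
    have "convex_gon k Q" "vertices Q \<subseteq> vertices P1 \<or> vertices Q \<subseteq> vertices P2"
      using Q D1' D2' by auto
    then show ?thesis
      using V subset_trans by metis
  qed
  moreover have "interior Q \<inter> interior R = {}" if "Q \<in> \<Q>1 \<union> \<Q>2" "R \<in> \<Q>1 \<union> \<Q>2" "Q \<noteq> R" for Q R
    using that
  proof (elim UnE)
    assume "Q \<in> \<Q>2" "R \<in> \<Q>1"
    then show ?thesis
      using disj[of R Q] by blast
  qed (use disj[of Q R] D1' D2' that(3) in simp_all)
  ultimately show ?thesis
    using D1 D2 P by (simp add: dissection_def)
qed

context labelled_polygon
begin

text \<open>Subpolygons are handled through index sets, so that vertices, cuts and vertex counts
  become statements about sets of numbers.\<close>

definition gon :: "nat set \<Rightarrow> (real^2) set" where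
  "gon I = convex hull (v ` I)"

lemma extreme_v: "i \<in> {1..N} \<Longrightarrow> v i extreme_point_of P"
  using vertices_P by (auto simp: vertices_def)

lemma v_eq_iff: "i \<in> {1..N} \<Longrightarrow> j \<in> {1..N} \<Longrightarrow> v i = v j \<longleftrightarrow> i = j"
  by (rule inj_on_eq_iff[OF inj_v])

lemma gon_subset: "I \<subseteq> {1..N} \<Longrightarrow> gon I \<subseteq> P"
  unfolding gon_def P_hull by (intro hull_mono image_mono)

lemma gon_mono: "I \<subseteq> J \<Longrightarrow> gon I \<subseteq> gon J"
  unfolding gon_def by (intro hull_mono image_mono)

lemma convex_P: "convex P"
  by (subst P_hull) (rule convex_convex_hull)

lemma P_eq_gon: "P = gon {1..N}"
  by (simp add: gon_def P_hull)

lemma v_in_gon: "i \<in> I \<Longrightarrow> v i \<in> gon I"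
  by (simp add: gon_def hull_inc)

lemma vertices_gon:
  assumes "I \<subseteq> {1..N}"
  shows "vertices (gon I) = v ` I"
proof
  show "vertices (gon I) \<subseteq> v ` I"
    unfolding vertices_def gon_def using extreme_points_of_convex_hull .
  show "v ` I \<subseteq> vertices (gon I)"
    using assms extreme_v v_in_gon gon_subset[OF assms]
    unfolding vertices_def extreme_point_of_def by blast
qed

lemma ccw': "i \<in> {1..N} \<Longrightarrow> j \<in> {1..N} \<Longrightarrow> l \<in> {1..N} \<Longrightarrow> i < j \<Longrightarrow> j < l \<Longrightarrow> 0 < orient (v i) (v j) (v l)"
  using ccw by simp

lemma orient_inside:
  assumes "p \<in> {1..N}" "q \<in> {1..N}" "p < x" "x < q"
  shows "orient (v p) (v q) (v x) < 0"
  using ccw'[of p x q] orient_swap[of "v p" "v q" "v x"] assms by simp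

lemma orient_outside:
  assumes "p \<in> {1..N}" "q \<in> {1..N}" "x \<in> {1..N}" "p < q" "x < p \<or> q < x"
  shows "0 < orient (v p) (v q) (v x)"
  using ccw'[of p q x] ccw'[of x p q] orient_rotate[of "v x" "v p" "v q"] assms by auto

lemma orient_gon_inside:
  assumes "p \<in> {1..N}" "q \<in> {1..N}" "I \<subseteq> {p..q}" "x \<in> gon I"
  shows "orient (v p) (v q) x \<le> 0"
proof -
  have "v ` I \<subseteq> {x. orient (v p) (v q) x \<le> 0}"
  proof clarify
    fix i assume "i \<in> I"
    then consider "i = p" | "i = q" | "p < i" "i < q"
      using assms(3) by fastforce
    then show "orient (v p) (v q) (v i) \<le> 0"
      using orient_inside[OF assms(1,2), of i] by cases auto
  qed
  then have "gon I \<subseteq> {x. orient (v p) (v q) x \<le> 0}"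
    unfolding gon_def by (rule hull_minimal) (rule convex_orient_halfplanes)
  then show ?thesis
    using assms by auto
qed

lemma orient_gon_outside:
  assumes "p \<in> {1..N}" "q \<in> {1..N}" "p < q" "I \<subseteq> {1..N} - {p<..<q}" "x \<in> gon I"
  shows "0 \<le> orient (v p) (v q) x"
proof -
  have "v ` I \<subseteq> {x. 0 \<le> orient (v p) (v q) x}"
  proof clarify
    fix i assume i: "i \<in> I"
    then consider "i = p" | "i = q" | "i < p \<or> q < i"
      using assms(4) by fastforce
    then show "0 \<le> orient (v p) (v q) (v i)"
      using orient_outside[OF assms(1,2), of i] assms i by cases auto
  qed
  then have "gon I \<subseteq> {x. 0 \<le> orient (v p) (v q) x}"
    unfolding gon_def by (rule hull_minimal) (rule convex_orient_halfplanes)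
  then show ?thesis
    using assms by auto
qed

lemma on_chord:
  assumes "p \<in> {1..N}" "q \<in> {1..N}" "p \<noteq> q" "z \<in> P" "orient (v p) (v q) z = 0"
  shows "z \<in> closed_segment (v p) (v q)"
  using assms by (intro extreme_points_on_line[of _ P]) (auto simp: extreme_v v_eq_iff)

lemma convex_gon_gon:
  assumes I: "I \<subseteq> {1..N}" "3 \<le> card I"
  shows "convex_gon (card I) (gon I)"
proof -
  have fin: "finite I"
    using assms finite_subset by blast
  have card: "card (vertices (gon I)) = card I"
    unfolding vertices_gon[OF I(1)] using inj_on_subset[OF inj_v I(1)] by (rule card_image)
  \<comment> \<open>The three smallest indices give a triangle of positive area, which forces affine
    dimension 2.\<close>
  obtain b where b: "b \<in> I" "card (I \<inter> {..b}) = 2"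
    using ex_element_with_rank[OF fin, of 2] I by auto
  obtain a where a: "a \<in> I" "card (I \<inter> {..a}) = 1"
    using ex_element_with_rank[OF fin, of 1] I by auto
  obtain c where c: "c \<in> I" "card (I \<inter> {..c}) = 3"
    using ex_element_with_rank[OF fin, of 3] I by auto
  have less: "x < y" if "card (I \<inter> {..x}) < card (I \<inter> {..y})" for x y
  proof (rule ccontr)
    assume "\<not> x < y"
    then have "card (I \<inter> {..y}) \<le> card (I \<inter> {..x})"
      using fin by (intro card_mono) auto
    with that show False
      by simp
  qed
  have "0 < orient (v a) (v b) (v c)"
    using a b c less[of a b] less[of b c] I by (intro ccw') auto
  then have "\<not> collinear {v a, v b, v c}"
    using collinear_imp_orient_eq_0 by fastforce
  then have "\<not> collinear (gon I)"
    using a b c v_in_gon collinear_subset[of "gon I" "{v a, v b, v c}"] by blast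
  then have "aff_dim (gon I) = 2"
    using aff_dim_le_DIM[of "gon I"] by (simp add: collinear_aff_dim)
  then show ?thesis
    using card fin by (simp add: convex_gon_def gon_def polytope_convex_hull)
qed

text \<open>A segment between the two parts crosses the line of the chord inside \<open>P\<close>,
  hence on the chord itself, which belongs to both parts. So the union is convex and contains the
  hull. The interiors lie in opposite open half-planes.\<close>

lemma gon_split:
  assumes I: "I \<subseteq> {1..N}" and pq: "p \<in> I" "q \<in> I" "p < q"
  shows "gon I = gon (I \<inter> {p..q}) \<union> gon (I - {p<..<q})"
    and "interior (gon (I \<inter> {p..q})) \<inter> interior (gon (I - {p<..<q})) = {}"
proof -
  let ?A = "gon (I \<inter> {p..q})" and ?B = "gon (I - {p<..<q})"
  have pqN: "p \<in> {1..N}" "q \<in> {1..N}"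
    using I pq by auto
  have A: "orient (v p) (v q) x \<le> 0" if "x \<in> ?A" for x
    using orient_gon_inside[OF pqN _ that] by auto
  have B: "0 \<le> orient (v p) (v q) x" if "x \<in> ?B" for x
    using orient_gon_outside[OF pqN pq(3) _ that] I by auto
  have cA: "convex ?A" and cB: "convex ?B"
    by (simp_all add: gon_def)
  have chord: "closed_segment (v p) (v q) \<subseteq> ?A" "closed_segment (v p) (v q) \<subseteq> ?B"
    using pq by (simp_all add: closed_segment_subset cA cB v_in_gon)
  have seg: "closed_segment y z \<subseteq> ?A \<union> ?B" if y: "y \<in> ?A" and z: "z \<in> ?B" for y z
  proof -
    obtain w where w: "w \<in> closed_segment y z" "orient (v p) (v q) w = 0"
      using crosses_line[OF A[OF y] B[OF z]] .
    have "I \<inter> {p..q} \<subseteq> {1..N}" "I - {p<..<q} \<subseteq> {1..N}"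
      using I by auto
    then have "?A \<subseteq> P" "?B \<subseteq> P"
      by (simp_all only: gon_subset)
    then have "w \<in> P"
      using w(1) y z closed_segment_subset[of y P z] convex_P by blast
    then have "w \<in> closed_segment (v p) (v q)"
      using w pqN pq by (intro on_chord) auto
    then have "w \<in> ?A" "w \<in> ?B"
      using chord by blast+
    then have "closed_segment y w \<subseteq> ?A" "closed_segment w z \<subseteq> ?B"
      using y z by (simp_all add: closed_segment_subset cA cB)
    then show ?thesis
      using Un_closed_segment[OF w(1)] by blast
  qed
  have "convex (?A \<union> ?B)"
    unfolding convex_contains_segment
  proof (intro ballI)
    fix x y assume "x \<in> ?A \<union> ?B" "y \<in> ?A \<union> ?B"
    then consider "x \<in> ?A" "y \<in> ?A" | "x \<in> ?B" "y \<in> ?B" | "x \<in> ?A" "y \<in> ?B" | "y \<in> ?A" "x \<in> ?B"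
      by blast
    then show "closed_segment x y \<subseteq> ?A \<union> ?B"
    proof cases
      case 1
      then show ?thesis
        using closed_segment_subset[OF _ _ cA] by blast
    next
      case 2
      then show ?thesis
        using closed_segment_subset[OF _ _ cB] by blast
    next
      case 3
      then show ?thesis
        by (rule seg)
    next
      case 4
      then show ?thesis
        by (subst closed_segment_commute) (rule seg)
    qed
  qed
  moreover have "v ` I \<subseteq> ?A \<union> ?B"
  proof (rule image_subsetI)
    fix i assume i: "i \<in> I"
    show "v i \<in> ?A \<union> ?B"
    proof (cases "i \<in> {p..q}")
      case True
      with i have "v i \<in> ?A"
        by (intro v_in_gon) simp
      then show ?thesis
        by simp
    next
      case False
      with i have "v i \<in> ?B"
        by (intro v_in_gon) auto
      then show ?thesis
        by simp
    qed
  qed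
  ultimately have "gon I \<subseteq> ?A \<union> ?B"
    unfolding gon_def[of I] by (rule hull_minimal[rotated])
  moreover have "?A \<subseteq> gon I" "?B \<subseteq> gon I"
    by (simp_all add: gon_mono)
  ultimately show "gon I = ?A \<union> ?B"
    by blast
  have "v p \<noteq> v q"
    using pq pqN by (simp add: v_eq_iff)
  then have "interior ?A \<subseteq> {x. orient (v p) (v q) x < 0}" "interior ?B \<subseteq> {x. 0 < orient (v p) (v q) x}"
    unfolding interior_orient_halfplanes[OF \<open>v p \<noteq> v q\<close>, symmetric]
    using A B by (simp_all add: interior_mono subsetI)
  then show "interior ?A \<inter> interior ?B = {}"
    by fastforce
qed

section \<open>Existence of dissections and allowability of chords\<close>

lemma dissection_split:
  assumes I: "I \<subseteq> {1..N}" and pq: "p \<in> I" "q \<in> I" "p < q"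
    and "dissection k t1 (gon (I \<inter> {p..q})) \<Q>1" "dissection k t2 (gon (I - {p<..<q})) \<Q>2"
  shows "dissection k (t1 + t2) (gon I) (\<Q>1 \<union> \<Q>2)"
proof (rule dissection_Un[OF assms(5,6) gon_split[OF I pq]])
  have "I \<inter> {p..q} \<subseteq> {1..N}" "I - {p<..<q} \<subseteq> {1..N}"
    using I by auto
  then show "vertices (gon (I \<inter> {p..q})) \<subseteq> vertices (gon I)"
    "vertices (gon (I - {p<..<q})) \<subseteq> vertices (gon I)"
    using I by (auto simp: vertices_gon)
qed

text \<open>Each step cuts off the k-gon made of the k - 1 smallest indices and the largest one. The
  piece \<open>J\<close> containing the smallest and the largest index is recorded because the chord
  joining them is one of its sides.\<close>

lemma dissection_exists:
  assumes k: "3 \<le> k" and "1 \<le> t"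
  shows "I \<subseteq> {1..N} \<Longrightarrow> card I = t * (k - 2) + 2 \<Longrightarrow>
    \<exists>\<Q> J. dissection k t (gon I) \<Q> \<and> gon J \<in> \<Q> \<and> J \<subseteq> I \<and> Min I \<in> J \<and> Max I \<in> J"
  using \<open>1 \<le> t\<close>
proof (induction t arbitrary: I rule: nat_induct_at_least)
  case base
  have fin: "finite I"
    using base finite_subset by blast
  have "card I = k"
    using base k by simp
  then have "dissection k 1 (gon I) {gon I}" "I \<noteq> {}"
    using convex_gon_gon[OF base(1)] k by (auto simp: dissection_def)
  then show ?case
    using Min_in[OF fin] Max_in[OF fin] by blast
next
  case (Suc t)
  have fin: "finite I" and "I \<noteq> {}"
    using Suc.prems finite_subset by (blast, auto)
  have card: "card I = t * (k - 2) + k"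
    using Suc.prems k by simp
  have "1 \<le> k - 1" "k - 1 \<le> card I"
    using card k by auto
  then obtain p where p: "p \<in> I" "card (I \<inter> {..p}) = k - 1"
    using ex_element_with_rank[OF fin] by metis
  define q where "q = Max I"
  have q: "q \<in> I" "\<And>i. i \<in> I \<Longrightarrow> i \<le> q"
    using fin \<open>I \<noteq> {}\<close> by (auto simp: q_def)
  have split: "card (I - {..p}) = t * (k - 2) + 1"
    using card p fin k card_Diff_subset_Int[of I "{..p}"] by (simp add: Int_commute)
  have "p < q"
  proof (rule ccontr)
    assume "\<not> p < q"
    then have "I - {..p} = {}"
      using q(2) by force
    with split show False
      by simp
  qed
  let ?I1 = "I \<inter> {p..q}" and ?I2 = "I - {p<..<q}"
  \<comment> \<open>Both parts keep the endpoints p and q of the cut, which is why their sizes are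
    t(k - 2) + 2 and k.\<close>
  have I1: "?I1 = insert p (I - {..p})"
    using p q by force
  have I2: "?I2 = insert q (I \<inter> {..p})"
    using \<open>p < q\<close> q by force
  have cards: "card ?I1 = t * (k - 2) + 2" "card ?I2 = k"
    unfolding I1 I2 using fin split p \<open>p < q\<close> k by auto
  obtain \<Q>1 where \<Q>1: "dissection k t (gon ?I1) \<Q>1"
    using Suc.IH[of ?I1] Suc.prems cards by blast
  have "convex_gon k (gon ?I2)"
    using convex_gon_gon[of ?I2] Suc.prems cards k by auto
  then have "dissection k 1 (gon ?I2) {gon ?I2}"
    by (auto simp: dissection_def)
  then have "dissection k (t + 1) (gon I) (\<Q>1 \<union> {gon ?I2})"
    using \<Q>1 Suc.prems p q \<open>p < q\<close> by (intro dissection_split)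
  moreover have "Min I \<in> ?I2"
    using Min_in[OF fin \<open>I \<noteq> {}\<close>] Min_le[OF fin p(1)] by auto
  moreover have "Max I \<in> ?I2"
    using q(1) by (auto simp: q_def)
  ultimately show ?case
    by (intro exI[of _ "\<Q>1 \<union> {gon ?I2}"] exI[of _ ?I2]) auto
qed

text \<open>All vertices of \<open>gon J\<close> lie on one side of the chord, so its line supports
  the polygon and meets it in the chord alone.\<close>

lemma chord_edge_of_gon:
  assumes "p \<in> J" "q \<in> J" "p < q" "J \<subseteq> {p..q}" "J \<subseteq> {1..N}"
  shows "closed_segment (v p) (v q) edge_of gon J"
proof -
  have pq: "p \<in> {1..N}" "q \<in> {1..N}"
    using assms by auto
  let ?n = "left_normal (v p) (v q)"
  have "gon J \<inter> {x. ?n \<bullet> x = ?n \<bullet> v p} face_of gon J"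
    using orient_gon_inside[OF pq assms(4)]
    by (intro face_of_Int_supporting_hyperplane_le) (auto simp: gon_def orient_inner)
  moreover have "gon J \<inter> {x. ?n \<bullet> x = ?n \<bullet> v p} = closed_segment (v p) (v q)"
  proof
    show "gon J \<inter> {x. ?n \<bullet> x = ?n \<bullet> v p} \<subseteq> closed_segment (v p) (v q)"
    proof
      fix x assume "x \<in> gon J \<inter> {x. ?n \<bullet> x = ?n \<bullet> v p}"
      then have "x \<in> P" "orient (v p) (v q) x = 0"
        using gon_subset[OF assms(5)] by (auto simp: orient_inner)
      then show "x \<in> closed_segment (v p) (v q)"
        using on_chord[OF pq] assms(3) by simp
    qed
    have "closed_segment (v p) (v q) \<subseteq> gon J"
      using assms by (intro closed_segment_subset v_in_gon) (auto simp: gon_def)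
    moreover have "?n \<bullet> x = ?n \<bullet> v p" if "x \<in> closed_segment (v p) (v q)" for x
      using orient_closed_segment[OF that] by (simp add: orient_inner)
    ultimately show "closed_segment (v p) (v q) \<subseteq> gon J \<inter> {x. ?n \<bullet> x = ?n \<bullet> v p}"
      by blast
  qed
  moreover have "aff_dim (closed_segment (v p) (v q)) = 1"
    using assms(3) pq by (simp add: segment_convex_hull aff_dim_convex_hull v_eq_iff)
  ultimately show ?thesis
    by (simp add: edge_of_def)
qed

text \<open>A segment joining vertices on both sides crosses the chord in its relative interior. If
  the chord were a face, it would have to contain the ends of that segment.\<close>

lemma chord_not_edge:
  assumes pq: "p \<in> {1..N}" "q \<in> {1..N}" and x: "p < x" "x < q" and y: "y \<in> {1..N}" "y < p \<or> q < y"
  shows "\<not> closed_segment (v p) (v q) edge_of P"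
proof
  assume "closed_segment (v p) (v q) edge_of P"
  then have face: "closed_segment (v p) (v q) face_of P"
    by (simp add: edge_of_def)
  have neg: "orient (v p) (v q) (v x) < 0" and pos: "0 < orient (v p) (v q) (v y)"
    using orient_inside[OF pq x] orient_outside[OF pq y(1) _ y(2)] x by auto
  then obtain w where w: "w \<in> closed_segment (v x) (v y)" "orient (v p) (v q) w = 0"
    using crosses_line[of "v p" "v q" "v x" "v y"] by auto
  have xy: "v x \<in> P" "v y \<in> P"
    using extreme_v[of x] extreme_v[of y] pq x y by (auto simp: extreme_point_of_def)
  then have "w \<in> P"
    using w(1) closed_segment_subset[of "v x" P "v y"] convex_P by blast
  then have "w \<in> closed_segment (v p) (v q)"
    using pq x w(2) by (intro on_chord) auto
  moreover have "w \<in> open_segment (v x) (v y)"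
    using w neg pos by (auto simp: open_segment_def)
  ultimately have "v x \<in> closed_segment (v p) (v q)"
    using face xy unfolding face_of_def by blast
  then show False
    using orient_closed_segment neg by fastforce
qed

text \<open>At least one end of the inner chord lies strictly on one side of the outer line and the
  other end does not cross it. The open inner chord therefore avoids this line, even when the chords
  share an endpoint.\<close>

lemma nested_chords_noncrossing:
  assumes "p \<in> {1..N}" "q \<in> {1..N}" "p \<le> p'" "p' < q'" "q' \<le> q" "(p', q') \<noteq> (p, q)"
  shows "noncrossing (closed_segment (v p) (v q)) (closed_segment (v p') (v q'))"
    and "noncrossing (closed_segment (v p') (v q')) (closed_segment (v p) (v q))"
proof -
  have pq': "p' \<in> {1..N}" "q' \<in> {1..N}"
    using assms by auto
  then have ne: "v p \<noteq> v q" "v p' \<noteq> v q'"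
    using assms by (auto simp: v_eq_iff)
  have "p < q"
    using assms by auto
  have le: "orient (v p) (v q) (v i) \<le> 0" if "p \<le> i" "i \<le> q" for i
    using orient_gon_inside[OF assms(1,2), of "{i}"] v_in_gon[of i "{i}"] that by auto
  have "orient (v p) (v q) (v p') < 0 \<or> orient (v p) (v q) (v q') < 0"
    using orient_inside[OF assms(1,2), of p'] orient_inside[OF assms(1,2), of q'] assms by force
  then have "orient (v p) (v q) z < 0" if "z \<in> open_segment (v p') (v q')" for z
    using orient_open_segment_neg[OF le le _ that] assms by auto
  then have "rel_interior (closed_segment (v p) (v q)) \<inter> rel_interior (closed_segment (v p') (v q')) = {}"
    using orient_closed_segment[of _ "v p" "v q"] ne
    by (fastforce simp: rel_interior_closed_segment open_segment_def)
  moreover have "closed_segment (v p) (v q) \<noteq> closed_segment (v p') (v q')"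
    using assms pq' \<open>p < q\<close> by (auto simp: doubleton_eq_iff v_eq_iff)
  ultimately show "noncrossing (closed_segment (v p) (v q)) (closed_segment (v p') (v q'))"
    "noncrossing (closed_segment (v p') (v q')) (closed_segment (v p) (v q))"
    by (auto simp: noncrossing_def)
qed

text \<open>The chord separates polygons with t(k - 2) + 2 and (m - t)(k - 2) + 2 vertices, and both
  can be dissected. In the first, the piece through the lowest and highest index has the chord as a
  side.\<close>

lemma chord_allowable:
  assumes k: "3 \<le> k" and N: "N = m * (k - 2) + 2" and t: "1 \<le> t" "t < m"
    and pq: "1 \<le> p" "q \<le> N" "q = p + t * (k - 2) + 1"
  shows "closed_segment (v p) (v q) \<in> allowable_diagonals k m P"
proof -
  have pqN: "p \<in> {1..N}" "q \<in> {1..N}" "p < q"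
    using pq by auto
  have "1 \<le> t * (k - 2)"
    using t k by simp
  then have inner: "p < p + 1" "p + 1 < q"
    using pq by auto
  obtain u where u: "m = t + u" "1 \<le> u"
    using t by (metis less_imp_add_positive Suc_leI One_nat_def)
  have outer: "N = t * (k - 2) + u * (k - 2) + 2" "1 \<le> u * (k - 2)"
    using u N k by (simp_all add: distrib_right)
  \<comment> \<open>Since u \<ge> 1, some vertex lies on the far side: the last one if the chord
    starts at 1, otherwise the first one.\<close>
  have "\<exists>y\<in>{1..N}. y < p \<or> q < y"
  proof (cases "p = 1")
    case True
    then show ?thesis
      using outer pq by (intro bexI[of _ N]) auto
  next
    case False
    then show ?thesis
      using pq by (intro bexI[of _ 1]) auto
  qed
  then have "\<not> closed_segment (v p) (v q) edge_of P"
    using chord_not_edge[OF pqN(1,2) inner] by blast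
  moreover have "v p \<in> vertices P" "v q \<in> vertices P" "v p \<noteq> v q"
    using pqN vertices_P v_eq_iff[OF pqN(1,2)] by auto
  ultimately have diag: "closed_segment (v p) (v q) \<in> diagonals P"
    unfolding diagonals_def by blast
  let ?I1 = "{1..N} \<inter> {p..q}" and ?I2 = "{1..N} - {p<..<q}"
  have I1: "?I1 = {p..q}"
    using pqN by auto
  have "card {p..q} = t * (k - 2) + 2" "{p..q} \<subseteq> {1..N}"
    using pq pqN by auto
  then obtain \<Q>1 J where 1: "dissection k t (gon {p..q}) \<Q>1" "gon J \<in> \<Q>1" "J \<subseteq> {p..q}"
      "Min {p..q} \<in> J" "Max {p..q} \<in> J"
    using dissection_exists[OF k t(1)] by blast
  have D1: "dissection k t (gon ?I1) \<Q>1"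
    unfolding I1 by (rule 1(1))
  have "Min {p..q} = p" "Max {p..q} = q"
    using pqN by (auto intro!: Min_eqI Max_eqI)
  then have J: "p \<in> J" "q \<in> J"
    using 1(4,5) by simp_all
  have "card ?I2 = card {1..N} - card {p<..<q}"
    using pqN by (intro card_Diff_subset) auto
  then have "card ?I2 = u * (k - 2) + 2"
    using outer pq(3) by simp
  then obtain \<Q>2 where 2: "dissection k u (gon ?I2) \<Q>2"
    using dissection_exists[OF k u(2), of ?I2] by blast
  have "dissection k m P (\<Q>1 \<union> \<Q>2)"
    unfolding u(1) by (subst P_eq_gon) (rule dissection_split[OF subset_refl pqN D1 2])
  moreover have "closed_segment (v p) (v q) edge_of gon J"
    using J 1(3) pqN by (intro chord_edge_of_gon) auto
  ultimately show ?thesis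
    using diag 1(2) unfolding allowable_diagonals_def by blast
qed

end


theorem theorem5p1:
  fixes k m r s :: nat and P :: "(real^2) set"
  assumes "k \<ge> 3" and "m \<ge> 1"
    and "(k, m) \<noteq> (3, 1)"
    and "convex_gon (m * (k - 2) + 2) P"
    and "1 \<le> r" and "real r \<le> ((real m - 1) * (real k - 2) + 2) / (real k - 1)"
    and "1 \<le> s" and "s \<le> k - 1"
  shows "contains_copy (D_plus_complex k m P) (staircase r s)
       \<and> contains_copy (D_complex k m P) (staircase_slice r s)"
proof -
  define N where "N = m * (k - 2) + 2"
  \<comment> \<open>For r \<ge> m, clearing the denominator would leave m + k \<le> 4, which under
    the lower bounds only the excluded pair satisfies.\<close>
  have r_less: "r < m"
  proof (rule ccontr)
    assume "\<not> r < m"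
    then have "real m * (real k - 1) \<le> real r * (real k - 1)"
      using assms(1) by (intro mult_right_mono) auto
    also have "\<dots> \<le> (real m - 1) * (real k - 2) + 2"
      using assms(1,6) by (simp add: pos_le_divide_eq)
    finally have "real m + real k \<le> 4"
      by (simp add: algebra_simps)
    then show False
      using assms(1-3) by auto
  qed
  obtain v where "labelled_polygon N v P"
    using convex_gon_labelling[of N P] assms(4) by (auto simp: N_def)
  then interpret labelled_polygon N v P .
  \<comment> \<open>A chord of this length spans (m - i)(k - 2) + 2 consecutive vertices, enough for
    m - i pieces, so \<open>chord_allowable\<close> applies with t = m - i.\<close>
  define len where "len i = (m - i) * (k - 2) + 1" for i
  define d where "d = (\<lambda>(i, j). closed_segment (v j) (v (j + len i)))"
  let ?G = "{1..m - 1} \<times> {1..s}"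
  have len_pos: "0 < len i" for i
    by (simp add: len_def)
  have len_less: "len i' + (k - 2) \<le> len i" if "i < i'" "i' < m" for i i'
  proof -
    have "(m - i' + 1) * (k - 2) \<le> (m - i) * (k - 2)"
      using that by (intro mult_right_mono) auto
    then show ?thesis
      by (simp add: len_def)
  qed
  \<comment> \<open>The extreme case is i = 1, j = k - 1, where (k - 1) + (m - 1)(k - 2) + 1 =
    N.\<close>
  have ends: "j \<in> {1..N}" "j + len i \<in> {1..N}" if "i \<in> {1..m - 1}" "j \<in> {1..s}" for i j
  proof -
    have "len i \<le> (m - 1) * (k - 2) + 1"
      using that by (auto simp: len_def intro: mult_right_mono)
    moreover have "m * (k - 2) = (m - 1) * (k - 2) + (k - 2)"
      using assms(2) by (cases m) auto
    moreover have "j \<le> (k - 2) + 1"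
      using that assms(1,8) by auto
    ultimately have "j + len i \<le> N"
      unfolding N_def by linarith
    then show "j \<in> {1..N}" "j + len i \<in> {1..N}"
      using that by auto
  qed
  have allowable: "d ` ?G \<subseteq> allowable_diagonals k m P"
  proof clarify
    fix i j assume ij: "i \<in> {1..m - 1}" "j \<in> {1..s}"
    then show "d (i, j) \<in> allowable_diagonals k m P"
      using ends[OF ij] chord_allowable[OF assms(1) N_def, of "m - i" j "j + len i"]
      by (auto simp: d_def len_def)
  qed
  have inj: "inj_on d ?G"
  proof (rule inj_onI, clarify)
    fix i j i' j'
    assume ij: "i \<in> {1..m - 1}" "j \<in> {1..s}" "i' \<in> {1..m - 1}" "j' \<in> {1..s}"
      and "d (i, j) = d (i', j')"
    \<comment> \<open>A segment determines its pair of endpoints. Positive length tells which is the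
      start, so j and the length are recovered, and the length strictly decreases with i.\<close>
    then have "{v j, v (j + len i)} = {v j', v (j' + len i')}"
      by (simp add: d_def)
    then have eq: "j = j'" "len i = len i'"
      using ends[OF ij(1,2)] ends[OF ij(3,4)] len_pos[of i] len_pos[of i']
      by (auto simp: doubleton_eq_iff v_eq_iff simp del: atLeastAtMost_iff)
    moreover have "i = i'"
    proof (rule ccontr)
      have lt: "i < m" "i' < m" and k: "1 \<le> k - 2"
        using ij r_less assms(1) by auto
      assume "i \<noteq> i'"
      then have "i < i' \<or> i' < i"
        by linarith
      then have "len i' < len i \<or> len i < len i'"
        using len_less[OF _ lt(1), of i'] len_less[OF _ lt(2), of i] k by linarith
      with eq(2) show False
        by simp
    qed
    ultimately show "i = i' \<and> j = j'"
      by simp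
  qed
  have nested: "noncrossing (d (i, j)) (d (i', j')) \<and> noncrossing (d (i', j')) (d (i, j))"
    if "1 \<le> i" "i < i'" "i' \<le> m - 1" "1 \<le> j" "j \<le> j'" "j' \<le> s" for i j i' j'
  proof -
    have "len i' + (k - 2) \<le> len i"
      using len_less[of i i'] that r_less by simp
    \<comment> \<open>The start moves right by at most k - 2 and the length drops by at least k - 2,
      so the end does not move right.\<close>
    moreover have "j' \<le> j + (k - 2)" "1 \<le> k - 2"
      using that assms(1,8) by auto
    ultimately have "j' + len i' \<le> j + len i" "len i' < len i"
      by linarith+
    then show ?thesis
      using nested_chords_noncrossing[of j "j + len i" j' "j' + len i'"] ends[of i j] that len_pos[of i']
      by (auto simp: d_def)
  qed
  have r: "0 < r" "r \<le> m - 1"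
    using assms(5) r_less by auto
  have sub: "{1..r} \<times> {1..s} \<subseteq> ?G"
    using r by auto
  have "d ` ({1..r} \<times> {1..s}) \<subseteq> allowable_diagonals k m P"
    using image_mono[OF sub] allowable by (rule subset_trans)
  then have "contains_copy (D_plus_complex k m P) (staircase r s)"
    unfolding D_plus_complex_def using r inj_on_subset[OF inj sub]
    by (intro contains_copy_Hom_plus[where f = d]) simp_all
  moreover have "contains_copy (D_complex k m P) (staircase_slice r s)"
    unfolding D_complex_def
    by (rule contains_copy_Hom[OF r assms(7) inj allowable]) (rule nested)
  ultimately show ?thesis
    by (rule conjI)
qed

end
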